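(* Let $\mathcal{D}$ be a dense subspace of a Hilbert space $\mathcal{H}$, let $\rho$ be a faithful normal semifinite trace on a von Neumann algebra, and let $\Phi:\mathcal{L}^\dagger(\mathcal{D},\mathcal{H})\times\mathcal{L}^\dagger(\mathcal{D},\mathcal{H})\to L^2(\rho)$ be a positive sesquilinear map. Let $A,B,K\in\mathcal{L}^\dagger(\mathcal{D},\mathcal{H})$ be symmetric operators (i.e. $A=A^\dagger$, $B=B^\dagger$, $K=K^\dagger$) satisfying (a) $\Phi(AX,Y)=\Phi(X,AY)$ and $\Phi(BX,Y)=\Phi(X,BY)$ for every $X,Y\in\mathcal{L}^\dagger(\mathcal{D})_b$; (b) $\Phi(AX,BY)-\Phi(BX,AY)=\Phi(iKX,Y)$ for all $X,Y\in\mathcal{L}^\dagger(\mathcal{D})_b$. Then, for every $\lambda,\mu\in\mathbb{R}$, $$(\Delta A)_\Phi(\lambda)\,(\Delta B)_\Phi(\mu)\ge\tfrac12\,\gamma_\Phi(K),$$ where $\gamma_\Phi(K)=\|\Phi(K,I)\|_2$.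
   Context: $\mathcal{L}^\dagger(\mathcal{D},\mathcal{H})$ is the set of all closable operators $A$ in $\mathcal{H}$ with domain $D(A)=\mathcal{D}$ and $D(A^* )\supset\mathcal{D}$, with involution $A^\dagger:=A^*\upharpoonright\mathcal{D}$ (the restriction of the adjoint to $\mathcal{D}$). $\mathcal{L}^\dagger(\mathcal{D})_b$ is the *-algebra of bounded operators $A\in\mathcal{L}^\dagger(\mathcal{D},\mathcal{H})$ such that $A\mathcal{D}\subset\mathcal{D}$ and $A^\dagger\mathcal{D}\subset\mathcal{D}$. $I$ denotes the identity operator on $\mathcal{D}$. For a symmetric $A\in\mathcal{L}^\dagger(\mathcal{D},\mathcal{H})$ and $\lambda\in\mathbb{R}$, $$(\Delta A)_\Phi(\lambda)=\|\Phi(A-\lambda I,A-\lambda I)\|_2^{1/2}.$$ $L^2(\rho)$ is the noncommutative $L^2$-space of the von Neumann algebra with trace $\rho$, with norm $\|X\|_2=\rho(|X|^2)^{1/2}$, $|X|=(X^*X)^{1/2}$. Sesquilinear means linear in the first variable and conjugate-linear in the second; $\Phi$ is positive if $\Phi(T,T)\ge 0$ in $L^2(\rho)$ for every $T$. *)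

theory Defs
  imports "HOL-Analysis.Analysis" "HOL-Library.FuncSet" "HOL-Library.Nonpos_Ints"
begin

text \<open>Inner products are linear in the first and conjugate-linear in the second variable. The real
  inner product, and with it norm and topology, is the one underlying the complex inner product.\<close>

class complex_hilbert = real_inner + complete_space +
  fixes scaleC :: "complex \<Rightarrow> 'a \<Rightarrow> 'a" (infixr "*\<^sub>C" 75)
    and cinner :: "'a \<Rightarrow> 'a \<Rightarrow> complex"
  assumes scaleC_add_right: "a *\<^sub>C (x + y) = a *\<^sub>C x + a *\<^sub>C y"
    and scaleC_add_left: "(a + b) *\<^sub>C x = a *\<^sub>C x + b *\<^sub>C x"
    and scaleC_scaleC: "a *\<^sub>C (b *\<^sub>C x) = (a * b) *\<^sub>C x"
    and scaleR_scaleC: "r *\<^sub>R x = complex_of_real r *\<^sub>C x"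
    and cinner_commute: "cinner x y = cnj (cinner y x)"
    and cinner_add_left: "cinner (x + y) z = cinner x z + cinner y z"
    and cinner_scaleC_left: "cinner (a *\<^sub>C x) y = a * cinner x y"
    and Re_cinner: "Re (cinner x y) = inner x y"

definition csubspace :: "'h::complex_hilbert set \<Rightarrow> bool" where
  "csubspace D \<longleftrightarrow> 0 \<in> D \<and> (\<forall>x\<in>D. \<forall>y\<in>D. x + y \<in> D) \<and> (\<forall>c. \<forall>x\<in>D. c *\<^sub>C x \<in> D)"

text \<open>An operator with domain \<open>D\<close> is a function in \<^const>\<open>extensional\<close> \<open>D\<close>, so that two operators
  with domain \<open>D\<close> are equal iff they agree on \<open>D\<close>. The product of operators is \<^const>\<open>compose\<close> \<open>D\<close>.
  Everywhere defined operators are the case \<open>D = UNIV\<close>.\<close>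

definition op_add :: "'h::complex_hilbert set \<Rightarrow> ('h \<Rightarrow> 'h) \<Rightarrow> ('h \<Rightarrow> 'h) \<Rightarrow> ('h \<Rightarrow> 'h)" where
  "op_add D S T = (\<lambda>\<xi>\<in>D. S \<xi> + T \<xi>)"

definition op_diff :: "'h::complex_hilbert set \<Rightarrow> ('h \<Rightarrow> 'h) \<Rightarrow> ('h \<Rightarrow> 'h) \<Rightarrow> ('h \<Rightarrow> 'h)" where
  "op_diff D S T = (\<lambda>\<xi>\<in>D. S \<xi> - T \<xi>)"

definition op_scale :: "'h::complex_hilbert set \<Rightarrow> complex \<Rightarrow> ('h \<Rightarrow> 'h) \<Rightarrow> ('h \<Rightarrow> 'h)" where
  "op_scale D c S = (\<lambda>\<xi>\<in>D. c *\<^sub>C S \<xi>)"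

definition op_id :: "'h::complex_hilbert set \<Rightarrow> ('h \<Rightarrow> 'h)" where
  "op_id D = (\<lambda>\<xi>\<in>D. \<xi>)"

definition linear_op :: "'h::complex_hilbert set \<Rightarrow> ('h \<Rightarrow> 'h) \<Rightarrow> bool" where
  "linear_op D A \<longleftrightarrow> A \<in> extensional D \<and> (\<forall>\<xi>\<in>D. \<forall>\<eta>\<in>D. A (\<xi> + \<eta>) = A \<xi> + A \<eta>) \<and>
     (\<forall>c. \<forall>\<xi>\<in>D. A (c *\<^sub>C \<xi>) = c *\<^sub>C A \<xi>)"

definition bounded_op :: "'h::complex_hilbert set \<Rightarrow> ('h \<Rightarrow> 'h) \<Rightarrow> bool" where
  "bounded_op D A \<longleftrightarrow> (\<exists>C. \<forall>\<xi>\<in>D. norm (A \<xi>) \<le> C * norm \<xi>)"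

definition closable_op :: "'h::complex_hilbert set \<Rightarrow> ('h \<Rightarrow> 'h) \<Rightarrow> bool" where
  "closable_op D A \<longleftrightarrow> (\<forall>\<xi> \<eta>. (\<forall>n::nat. \<xi> n \<in> D) \<and> \<xi> \<longlonglongrightarrow> 0 \<and> (\<lambda>n. A (\<xi> n)) \<longlonglongrightarrow> \<eta> \<longrightarrow> \<eta> = 0)"

definition adj_dom :: "'h::complex_hilbert set \<Rightarrow> ('h \<Rightarrow> 'h) \<Rightarrow> 'h set" where
  "adj_dom D A = {\<eta>. \<exists>\<zeta>. \<forall>\<xi>\<in>D. cinner (A \<xi>) \<eta> = cinner \<xi> \<zeta>}"

definition adj :: "'h::complex_hilbert set \<Rightarrow> ('h \<Rightarrow> 'h) \<Rightarrow> ('h \<Rightarrow> 'h)" where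
  "adj D A = (\<lambda>\<eta>\<in>adj_dom D A. THE \<zeta>. \<forall>\<xi>\<in>D. cinner (A \<xi>) \<eta> = cinner \<xi> \<zeta>)"

definition L_dagger :: "'h::complex_hilbert set \<Rightarrow> ('h \<Rightarrow> 'h) set" where
  "L_dagger D = {A. linear_op D A \<and> closable_op D A \<and> D \<subseteq> adj_dom D A}"

definition dagger :: "'h::complex_hilbert set \<Rightarrow> ('h \<Rightarrow> 'h) \<Rightarrow> ('h \<Rightarrow> 'h)" where
  "dagger D A = restrict (adj D A) D"

definition L_dagger_b :: "'h::complex_hilbert set \<Rightarrow> ('h \<Rightarrow> 'h) set" where
  "L_dagger_b D = {A \<in> L_dagger D. bounded_op D A \<and> A ` D \<subseteq> D \<and> dagger D A ` D \<subseteq> D}"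

definition symmetric_op :: "'h::complex_hilbert set \<Rightarrow> ('h \<Rightarrow> 'h) \<Rightarrow> bool" where
  "symmetric_op D A \<longleftrightarrow> dagger D A = A"

definition bounded_ops :: "('k::complex_hilbert \<Rightarrow> 'k) set" where
  "bounded_ops = {T. linear_op UNIV T \<and> bounded_op UNIV T}"

definition commutant :: "('k::complex_hilbert \<Rightarrow> 'k) set \<Rightarrow> ('k \<Rightarrow> 'k) set" where
  "commutant S = {T \<in> bounded_ops. \<forall>s\<in>S. T \<circ> s = s \<circ> T}"

definition von_neumann_algebra :: "('k::complex_hilbert \<Rightarrow> 'k) set \<Rightarrow> bool" where
  "von_neumann_algebra M \<longleftrightarrow>
     M \<subseteq> bounded_ops \<and> (\<forall>x\<in>M. adj UNIV x \<in> M) \<and> commutant (commutant M) = M"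

definition positive_op :: "('k::complex_hilbert \<Rightarrow> 'k) \<Rightarrow> bool" where
  "positive_op T \<longleftrightarrow> T \<in> bounded_ops \<and> (\<forall>\<xi>. cinner (T \<xi>) \<xi> \<in> \<real>\<^sub>\<ge>\<^sub>0)"

definition op_le :: "('k::complex_hilbert \<Rightarrow> 'k) \<Rightarrow> ('k \<Rightarrow> 'k) \<Rightarrow> bool" where
  "op_le S T \<longleftrightarrow> positive_op (op_diff UNIV T S)"

definition positive_part :: "('k::complex_hilbert \<Rightarrow> 'k) set \<Rightarrow> ('k \<Rightarrow> 'k) set" where
  "positive_part M = {x \<in> M. positive_op x}"

text \<open>A trace is a function on the positive part of \<open>M\<close>; its values elsewhere are irrelevant.\<close>

definition trace_on :: "('k::complex_hilbert \<Rightarrow> 'k) set \<Rightarrow> (('k \<Rightarrow> 'k) \<Rightarrow> ennreal) \<Rightarrow> bool" where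
  "trace_on M \<rho> \<longleftrightarrow>
     (\<forall>x\<in>positive_part M. \<forall>y\<in>positive_part M. \<rho> (op_add UNIV x y) = \<rho> x + \<rho> y) \<and>
     (\<forall>x\<in>positive_part M. \<forall>t\<ge>0. \<rho> (op_scale UNIV (complex_of_real t) x) = ennreal t * \<rho> x) \<and>
     (\<forall>x\<in>M. \<rho> (adj UNIV x \<circ> x) = \<rho> (x \<circ> adj UNIV x))"

definition faithful_trace :: "('k::complex_hilbert \<Rightarrow> 'k) set \<Rightarrow> (('k \<Rightarrow> 'k) \<Rightarrow> ennreal) \<Rightarrow> bool" where
  "faithful_trace M \<rho> \<longleftrightarrow> (\<forall>x\<in>positive_part M. \<rho> x = 0 \<longrightarrow> x = (\<lambda>_. 0))"

definition normal_trace :: "('k::complex_hilbert \<Rightarrow> 'k) set \<Rightarrow> (('k \<Rightarrow> 'k) \<Rightarrow> ennreal) \<Rightarrow> bool" where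
  "normal_trace M \<rho> \<longleftrightarrow>
     (\<forall>S s. S \<subseteq> positive_part M \<and> S \<noteq> {} \<and>
        (\<forall>x\<in>S. \<forall>y\<in>S. \<exists>z\<in>S. op_le x z \<and> op_le y z) \<and>
        s \<in> positive_part M \<and> (\<forall>x\<in>S. op_le x s) \<and>
        (\<forall>t\<in>positive_part M. (\<forall>x\<in>S. op_le x t) \<longrightarrow> op_le s t)
      \<longrightarrow> \<rho> s = (SUP x\<in>S. \<rho> x))"

definition semifinite_trace :: "('k::complex_hilbert \<Rightarrow> 'k) set \<Rightarrow> (('k \<Rightarrow> 'k) \<Rightarrow> ennreal) \<Rightarrow> bool" where
  "semifinite_trace M \<rho> \<longleftrightarrow>
     (\<forall>x\<in>positive_part M. x \<noteq> (\<lambda>_. 0) \<longrightarrow>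
        (\<exists>y\<in>positive_part M. y \<noteq> (\<lambda>_. 0) \<and> op_le y x \<and> \<rho> y < \<infinity>))"

text \<open>\<open>L2 M \<rho>\<close> is the completion of the ideal \<open>J2 M \<rho>\<close> of all \<open>x\<close> in \<open>M\<close> with
  \<open>\<rho>(|x|\<^sup>2) < \<infinity>\<close> in the norm \<open>sqrt (\<rho>(|x|\<^sup>2))\<close>. Its elements are equivalence classes
  of Cauchy sequences in \<open>J2 M \<rho>\<close>. Under the usual identification with the square-integrable
  measurable operators, the positive operators form the closure of the cone of positive elements of
  \<open>J2 M \<rho>\<close>, that is, the classes that contain a sequence of positive elements.\<close>

definition op_abs :: "('k::complex_hilbert \<Rightarrow> 'k) \<Rightarrow> ('k \<Rightarrow> 'k)" where
  "op_abs x = (THE p. positive_op p \<and> p \<circ> p = adj UNIV x \<circ> x)"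

definition J2 :: "('k::complex_hilbert \<Rightarrow> 'k) set \<Rightarrow> (('k \<Rightarrow> 'k) \<Rightarrow> ennreal) \<Rightarrow> ('k \<Rightarrow> 'k) set" where
  "J2 M \<rho> = {x \<in> M. \<rho> (op_abs x \<circ> op_abs x) < \<infinity>}"

definition norm2 :: "(('k::complex_hilbert \<Rightarrow> 'k) \<Rightarrow> ennreal) \<Rightarrow> ('k \<Rightarrow> 'k) \<Rightarrow> real" where
  "norm2 \<rho> x = sqrt (enn2real (\<rho> (op_abs x \<circ> op_abs x)))"

definition cauchy2 ::
  "('k::complex_hilbert \<Rightarrow> 'k) set \<Rightarrow> (('k \<Rightarrow> 'k) \<Rightarrow> ennreal) \<Rightarrow> (nat \<Rightarrow> 'k \<Rightarrow> 'k) set" where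
  "cauchy2 M \<rho> = {x. (\<forall>n. x n \<in> J2 M \<rho>) \<and>
     (\<forall>e>0. \<exists>N. \<forall>m\<ge>N. \<forall>n\<ge>N. norm2 \<rho> (op_diff UNIV (x m) (x n)) < e)}"

definition equiv2 ::
  "('k::complex_hilbert \<Rightarrow> 'k) set \<Rightarrow> (('k \<Rightarrow> 'k) \<Rightarrow> ennreal) \<Rightarrow> (nat \<Rightarrow> 'k \<Rightarrow> 'k) rel" where
  "equiv2 M \<rho> = {(x, y). x \<in> cauchy2 M \<rho> \<and> y \<in> cauchy2 M \<rho> \<and>
     (\<lambda>n. norm2 \<rho> (op_diff UNIV (x n) (y n))) \<longlonglongrightarrow> 0}"

definition L2 ::
  "('k::complex_hilbert \<Rightarrow> 'k) set \<Rightarrow> (('k \<Rightarrow> 'k) \<Rightarrow> ennreal) \<Rightarrow> (nat \<Rightarrow> 'k \<Rightarrow> 'k) set set" where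
  "L2 M \<rho> = cauchy2 M \<rho> // equiv2 M \<rho>"

definition L2_add ::
  "('k::complex_hilbert \<Rightarrow> 'k) set \<Rightarrow> (('k \<Rightarrow> 'k) \<Rightarrow> ennreal) \<Rightarrow>
   (nat \<Rightarrow> 'k \<Rightarrow> 'k) set \<Rightarrow> (nat \<Rightarrow> 'k \<Rightarrow> 'k) set \<Rightarrow> (nat \<Rightarrow> 'k \<Rightarrow> 'k) set" where
  "L2_add M \<rho> X Y = equiv2 M \<rho> `` {\<lambda>n. op_add UNIV (x n) (y n) | x y. x \<in> X \<and> y \<in> Y}"

definition L2_scale ::
  "('k::complex_hilbert \<Rightarrow> 'k) set \<Rightarrow> (('k \<Rightarrow> 'k) \<Rightarrow> ennreal) \<Rightarrow> complex \<Rightarrow>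
   (nat \<Rightarrow> 'k \<Rightarrow> 'k) set \<Rightarrow> (nat \<Rightarrow> 'k \<Rightarrow> 'k) set" where
  "L2_scale M \<rho> c X = equiv2 M \<rho> `` {\<lambda>n. op_scale UNIV c (x n) | x. x \<in> X}"

definition L2_diff ::
  "('k::complex_hilbert \<Rightarrow> 'k) set \<Rightarrow> (('k \<Rightarrow> 'k) \<Rightarrow> ennreal) \<Rightarrow>
   (nat \<Rightarrow> 'k \<Rightarrow> 'k) set \<Rightarrow> (nat \<Rightarrow> 'k \<Rightarrow> 'k) set \<Rightarrow> (nat \<Rightarrow> 'k \<Rightarrow> 'k) set" where
  "L2_diff M \<rho> X Y = L2_add M \<rho> X (L2_scale M \<rho> (-1) Y)"

definition L2_norm ::
  "(('k::complex_hilbert \<Rightarrow> 'k) \<Rightarrow> ennreal) \<Rightarrow> (nat \<Rightarrow> 'k \<Rightarrow> 'k) set \<Rightarrow> real" where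
  "L2_norm \<rho> X = (THE r. \<forall>x\<in>X. (\<lambda>n. norm2 \<rho> (x n)) \<longlonglongrightarrow> r)"

definition L2_nonneg :: "(nat \<Rightarrow> 'k::complex_hilbert \<Rightarrow> 'k) set \<Rightarrow> bool" where
  "L2_nonneg X \<longleftrightarrow> (\<exists>x\<in>X. \<forall>n. positive_op (x n))"

definition sesquilinear_L2 ::
  "'h::complex_hilbert set \<Rightarrow> ('k::complex_hilbert \<Rightarrow> 'k) set \<Rightarrow> (('k \<Rightarrow> 'k) \<Rightarrow> ennreal) \<Rightarrow>
   (('h \<Rightarrow> 'h) \<Rightarrow> ('h \<Rightarrow> 'h) \<Rightarrow> (nat \<Rightarrow> 'k \<Rightarrow> 'k) set) \<Rightarrow> bool" where
  "sesquilinear_L2 D M \<rho> \<Phi> \<longleftrightarrow>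
     (\<forall>S\<in>L_dagger D. \<forall>T\<in>L_dagger D. \<Phi> S T \<in> L2 M \<rho>) \<and>
     (\<forall>S\<in>L_dagger D. \<forall>T\<in>L_dagger D. \<forall>U\<in>L_dagger D.
        \<Phi> (op_add D S T) U = L2_add M \<rho> (\<Phi> S U) (\<Phi> T U) \<and>
        \<Phi> U (op_add D S T) = L2_add M \<rho> (\<Phi> U S) (\<Phi> U T)) \<and>
     (\<forall>c. \<forall>S\<in>L_dagger D. \<forall>T\<in>L_dagger D.
        \<Phi> (op_scale D c S) T = L2_scale M \<rho> c (\<Phi> S T) \<and>
        \<Phi> S (op_scale D c T) = L2_scale M \<rho> (cnj c) (\<Phi> S T))"

definition positive_sesq ::
  "'h::complex_hilbert set \<Rightarrow> (('h \<Rightarrow> 'h) \<Rightarrow> ('h \<Rightarrow> 'h) \<Rightarrow> (nat \<Rightarrow> 'k::complex_hilbert \<Rightarrow> 'k) set) \<Rightarrow>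
   bool" where
  "positive_sesq D \<Phi> \<longleftrightarrow> (\<forall>T\<in>L_dagger D. L2_nonneg (\<Phi> T T))"

definition uncertainty ::
  "'h::complex_hilbert set \<Rightarrow> (('k::complex_hilbert \<Rightarrow> 'k) \<Rightarrow> ennreal) \<Rightarrow>
   (('h \<Rightarrow> 'h) \<Rightarrow> ('h \<Rightarrow> 'h) \<Rightarrow> (nat \<Rightarrow> 'k \<Rightarrow> 'k) set) \<Rightarrow> ('h \<Rightarrow> 'h) \<Rightarrow> real \<Rightarrow> real" where
  "uncertainty D \<rho> \<Phi> A t =
     (let A' = op_diff D A (op_scale D (complex_of_real t) (op_id D))
      in sqrt (L2_norm \<rho> (\<Phi> A' A')))"

definition gamma_norm ::
  "'h::complex_hilbert set \<Rightarrow> (('k::complex_hilbert \<Rightarrow> 'k) \<Rightarrow> ennreal) \<Rightarrow>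
   (('h \<Rightarrow> 'h) \<Rightarrow> ('h \<Rightarrow> 'h) \<Rightarrow> (nat \<Rightarrow> 'k \<Rightarrow> 'k) set) \<Rightarrow> ('h \<Rightarrow> 'h) \<Rightarrow> real" where
  "gamma_norm D \<rho> \<Phi> K = L2_norm \<rho> (\<Phi> K (op_id D))"

end

theory Submission
  imports Defs
begin

text \<open>Put \<open>P = A - lam I\<close>, \<open>Q = B - mu I\<close> and \<open>k = \<Phi>(K, I)\<close>. With \<open>X = Y = I\<close> the hypotheses
  give \<open>\<Phi>(P, Q) - \<Phi>(Q, P) = \<i> k\<close> (\<open>rep_shifted_commutator\<close>). Positivity of \<open>\<Phi>\<close> at \<open>P + \<i> t Q\<close>, for
  real \<open>t\<close> of both signs, then says that \<open>-h \<le> t k \<le> h\<close> with \<open>h = \<Phi>(P, P) + t\<^sup>2 \<Phi>(Q, Q)\<close>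
  (\<open>rep_quadratic\<close>). If the norm of \<open>L\<^sup>2\<close> is monotone in this sense, it follows that
  \<open>\<parallel>k\<parallel> \<le> \<parallel>\<Phi>(P, P)\<parallel> / t + t \<parallel>\<Phi>(Q, Q)\<parallel>\<close> for all \<open>t > 0\<close>, and the best \<open>t\<close> gives the claim
  (\<open>lnorm_commutator_le\<close>). A Cauchy-Schwarz inequality for the operator-valued form \<open>\<Phi>\<close> itself would
  be a stronger statement; only the antisymmetric part of \<open>\<Phi>(P, Q)\<close> has to be estimated.

  Monotonicity of the norm (\<open>lnorm_le_of_dominated\<close>) amounts to \<open>\<parallel>x - y\<parallel> \<le> \<parallel>x + y\<parallel>\<close> for positive \<open>x\<close>
  and \<open>y\<close>, that is, to \<open>\<rho>(x y) \<ge> 0\<close> (\<open>nrm_diff_le_add\<close>). For \<open>y = w\<^sup>2\<close> with \<open>w\<close> square integrable this is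
  cyclicity of the trace, \<open>\<rho>(x w w) = \<rho>(w x w)\<close>. A general positive \<open>y\<close> with \<open>\<rho>(y\<^sup>2) < \<infinity>\<close> is the
  limit in 2-norm of the operators \<open>y - y (1 - y)\<^sup>n\<close>, scaled so that \<open>y \<le> 1\<close>, which have finite trace;
  the convergence is where normality of the trace is used.

  Everything else makes these arguments available: adjoints come from the Riesz representation
  theorem, square roots of positive operators from a fixed-point iteration, and the triangle inequality
  for the 2-norm from additivity of the trace on positive operators.\<close>

section \<open>Complex Hilbert spaces\<close>

lemma scaleC_one [simp]: "1 *\<^sub>C (x::'a::complex_hilbert) = x"
  using scaleR_scaleC[of 1 x] by simp

lemma scaleC_zero_left [simp]: "0 *\<^sub>C (x::'a::complex_hilbert) = 0"
  using scaleR_scaleC[of 0 x] by simp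

lemma scaleC_zero_right [simp]: "c *\<^sub>C (0::'a::complex_hilbert) = 0"
  using scaleC_add_right[of c 0 "0::'a"] by simp

lemma scaleC_minus_right: "c *\<^sub>C (- x) = - (c *\<^sub>C (x::'a::complex_hilbert))"
  using scaleC_add_right[of c x "- x"] by (simp add: add_eq_0_iff2)

lemma scaleC_minus_left: "(- c) *\<^sub>C x = - (c *\<^sub>C (x::'a::complex_hilbert))"
  using scaleC_add_left[of c "- c" x] by (simp add: add_eq_0_iff2)

lemma scaleC_scaleR_commute: "c *\<^sub>C (r *\<^sub>R x) = r *\<^sub>R (c *\<^sub>C (x::'a::complex_hilbert))"
  by (simp add: scaleR_scaleC scaleC_scaleC mult.commute)

lemma cinner_scaleC_right: "cinner x (a *\<^sub>C y) = cnj a * cinner x (y::'a::complex_hilbert)"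
  by (metis cinner_commute cinner_scaleC_left complex_cnj_mult)

lemma cinner_eq_inner: "cinner x y = Complex (inner x y) (inner x (\<i> *\<^sub>C (y::'a::complex_hilbert)))"
  by (rule complex_eqI) (simp_all add: Re_cinner[symmetric] cinner_scaleC_right)

lemma inner_scaleC_left: "inner (c *\<^sub>C x) y = inner x (cnj c *\<^sub>C (y::'a::complex_hilbert))"
  by (simp add: Re_cinner[symmetric] cinner_scaleC_right cinner_scaleC_left)

lemma norm_scaleC: "norm (c *\<^sub>C (x::'a::complex_hilbert)) = cmod c * norm x"
proof -
  have "(norm (c *\<^sub>C x))\<^sup>2 = inner x ((cnj c * c) *\<^sub>C x)"
    by (simp add: power2_norm_eq_inner inner_scaleC_left scaleC_scaleC)
  also have "(cnj c * c) *\<^sub>C x = ((cmod c)\<^sup>2) *\<^sub>R x"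
    by (metis complex_norm_square mult.commute scaleR_scaleC)
  also have "inner x \<dots> = (cmod c * norm x)\<^sup>2"
    by (simp add: power2_norm_eq_inner power_mult_distrib)
  finally show ?thesis
    by (metis abs_norm_cancel mult_nonneg_nonneg norm_ge_zero power2_eq_iff_nonneg)
qed

text \<open>First-order condition at a minimum: a quadratic in \<open>t\<close> that vanishes at \<open>0\<close> can only stay
  nonnegative if it has no linear term.\<close>

lemma linear_coefficient_zero:
  fixes d e :: real
  assumes "\<And>t. 0 \<le> t * d + t\<^sup>2 * e"
  shows "d = 0"
proof (rule ccontr)
  assume d: "d \<noteq> 0"
  define t where "t = - d / (\<bar>e\<bar> + 1)"
  have "t * d + t\<^sup>2 * e \<le> t * d + t\<^sup>2 * \<bar>e\<bar>"
    by (intro add_left_mono mult_left_mono) auto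
  also have "\<dots> = (d\<^sup>2 / (\<bar>e\<bar> + 1)\<^sup>2) * (- (\<bar>e\<bar> + 1) + \<bar>e\<bar>)"
    by (simp add: t_def power2_eq_square divide_simps) (simp add: algebra_simps)
  also have "\<dots> < 0"
    using d by (simp add: zero_less_divide_iff)
  finally show False
    using assms[of t] by simp
qed

text \<open>The representing vector is the minimizer of \<open>\<parallel>x\<parallel>\<^sup>2 - 2 f x\<close>. The parallelogram law bounds
  the distance of two almost minimizers, so every minimizing sequence is Cauchy and its limit is a
  minimizer; the derivative of the functional vanishes there.\<close>

lemma riesz_representation:
  fixes f :: "'a::{real_inner,complete_space} \<Rightarrow> real"
  assumes "bounded_linear f"
  obtains z where "\<And>x. f x = inner x z"
proof -
  interpret f: bounded_linear f by fact
  define F where "F x = (norm x)\<^sup>2 - 2 * f x" for x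
  obtain C where C: "\<And>x. norm (f x) \<le> norm x * C"
    using f.bounded by auto
  have low: "- C\<^sup>2 \<le> F x" for x
  proof -
    have "0 \<le> (norm x - C)\<^sup>2" by simp
    moreover have "f x \<le> norm x * C" using C[of x] by simp
    ultimately show ?thesis by (simp add: F_def power2_diff)
  qed
  then have bdd: "bdd_below (range F)" by (intro bdd_belowI2[of UNIV "- C\<^sup>2"])
  define m where "m = Inf (range F)"
  have m_le: "m \<le> F x" for x
    unfolding m_def by (rule cInf_lower[OF _ bdd]) simp
  have "\<exists>x. F x < m + 1 / Suc n" for n
  proof -
    have "Inf (range F) < m + 1 / Suc n" by (simp add: m_def)
    then show ?thesis using cInf_lessD[of "range F"] by blast
  qed
  then obtain x where x: "\<And>n. F (x n) < m + 1 / Suc n" by metis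
  have parallel: "(norm (u - v))\<^sup>2 = 2 * F u + 2 * F v - 4 * F ((1/2) *\<^sub>R (u + v))" for u v
    by (simp add: F_def power2_norm_eq_inner f.add f.scaleR inner_commute algebra_simps)
  have dist_sq: "(norm (u - v))\<^sup>2 \<le> 2 * (F u - m) + 2 * (F v - m)" for u v
    using parallel[of u v] m_le[of "(1/2) *\<^sub>R (u + v)"] by simp
  have "Cauchy x"
  proof (rule metric_CauchyI)
    fix e :: real assume e: "e > 0"
    then obtain N where N: "1 / Suc N < e\<^sup>2 / 4"
      using reals_Archimedean[of "e\<^sup>2 / 4"] by (auto simp: inverse_eq_divide)
    have "dist (x i) (x j) < e" if "i \<ge> N" "j \<ge> N" for i j
    proof -
      have b: "F (x k) - m < e\<^sup>2 / 4" if "k \<ge> N" for k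
      proof -
        have "1 / real (Suc k) \<le> 1 / Suc N"
          using that by (intro divide_left_mono) auto
        then show ?thesis using x[of k] N by linarith
      qed
      have "2 * (F (x i) - m) + 2 * (F (x j) - m) < e\<^sup>2"
        using add_strict_mono[OF b[OF that(1)] b[OF that(2)]] by simp
      then have "(norm (x i - x j))\<^sup>2 < e\<^sup>2"
        using dist_sq[of "x i" "x j"] by (rule order.strict_trans1[rotated])
      then show ?thesis
        using e by (simp add: dist_norm power2_less_imp_less)
    qed
    then show "\<exists>N. \<forall>i\<ge>N. \<forall>j\<ge>N. dist (x i) (x j) < e" by blast
  qed
  then obtain z where z: "x \<longlonglongrightarrow> z"
    using Cauchy_convergent convergent_def by blast
  have "(\<lambda>n. F (x n)) \<longlonglongrightarrow> F z"
    unfolding F_def by (intro tendsto_intros z f.tendsto)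
  moreover have "(\<lambda>n. m + 1 / real (Suc n)) \<longlonglongrightarrow> m + 0"
    using LIMSEQ_inverse_real_of_nat by (intro tendsto_intros) (simp add: inverse_eq_divide)
  ultimately have "F z \<le> m + 0"
    by (rule LIMSEQ_le) (use x in \<open>auto intro: less_imp_le\<close>)
  then have min: "F z \<le> F y" for y using m_le[of y] by simp
  have "f h = inner h z" for h
  proof -
    have "F (z + t *\<^sub>R h) - F z = t * (2 * (inner h z - f h)) + t\<^sup>2 * inner h h" for t
      unfolding F_def power2_norm_eq_inner
      by (simp add: f.add f.scaleR inner_commute inner_simps power2_eq_square algebra_simps)
    then have "0 \<le> t * (2 * (inner h z - f h)) + t\<^sup>2 * inner h h" for t
      using min[of "z + t *\<^sub>R h"] by (metis diff_ge_0_iff_ge)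
    from linear_coefficient_zero[OF this] show ?thesis by simp
  qed
  then show ?thesis by (rule that)
qed

section \<open>The algebra of bounded operators\<close>

lemma bounded_opsD:
  assumes "T \<in> bounded_ops"
  shows "T (x + y) = T x + T y" "T (c *\<^sub>C x) = c *\<^sub>C T x" "\<exists>C. \<forall>x. norm (T x) \<le> C * norm x"
  using assms by (auto simp: bounded_ops_def linear_op_def bounded_op_def)

lemma bounded_opsI:
  assumes "\<And>x y. T (x + y) = T x + T y" "\<And>c x. T (c *\<^sub>C x) = c *\<^sub>C T x"
    "\<And>x. norm (T x) \<le> C * norm x"
  shows "T \<in> bounded_ops"
  using assms by (auto simp: bounded_ops_def linear_op_def bounded_op_def)

lemma bounded_linear_bounded_ops: "T \<in> bounded_ops \<Longrightarrow> bounded_linear T"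
proof -
  assume T: "T \<in> bounded_ops"
  obtain C where "\<forall>x. norm (T x) \<le> C * norm x" using bounded_opsD(3)[OF T] by blast
  then show ?thesis
    by (intro bounded_linear_intro[of T C]) (auto simp: bounded_opsD[OF T] scaleR_scaleC mult.commute)
qed

text \<open>Bounded operators as a type of their own, so that identities between *-polynomials are instances
  of the ring laws. The Hilbert space may be zero, in which case \<open>0 = 1\<close> holds for operators; hence
  the unit comes from \<^class>\<open>monoid_mult\<close> and not from \<^class>\<open>ring_1\<close>.\<close>

typedef (overloaded) 'a bop = "bounded_ops :: ('a::complex_hilbert \<Rightarrow> 'a) set"
  morphisms app Bop
  by (rule exI[of _ "\<lambda>x. x"], rule bounded_opsI[of _ 1]) auto

setup_lifting type_definition_bop

lemma bounded_linear_app: "bounded_linear (app a)"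
  using app[of a] by (rule bounded_linear_bounded_ops)

lemma bop_eqI: "(\<And>x. app a x = app b x) \<Longrightarrow> a = b"
  by (metis app_inject ext)

lemma app_add_right [simp]: "app a (x + y) = app a x + app a y"
  using app[of a] by (rule bounded_opsD)

lemma app_scaleC [simp]: "app a (c *\<^sub>C x) = c *\<^sub>C app a x"
  using app[of a] by (rule bounded_opsD)

lemma app_scaleR [simp]: "app a (c *\<^sub>R x) = c *\<^sub>R app a x"
  by (simp add: scaleR_scaleC)

lemma app_diff_right [simp]: "app a (x - y) = app a x - app a y"
  using bounded_linear_app[of a] by (simp add: linear_simps)

lemma app_zero_right [simp]: "app a 0 = 0"
  using bounded_linear_app[of a] by (simp add: linear_simps)

lemma app_bounded: obtains C where "C > 0" "\<And>x. norm (app a x) \<le> C * norm x"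
  using bounded_linear.pos_bounded[OF bounded_linear_app[of a]] by (metis mult.commute)

instantiation bop :: (complex_hilbert) "{real_algebra, monoid_mult}"
begin

lift_definition zero_bop :: "'a bop" is "\<lambda>x. 0"
  by (rule bounded_opsI[of _ 0]) auto

lift_definition one_bop :: "'a bop" is "\<lambda>x. x"
  by (rule bounded_opsI[of _ 1]) auto

lift_definition plus_bop :: "'a bop \<Rightarrow> 'a bop \<Rightarrow> 'a bop" is "\<lambda>S T x. S x + T x"
proof -
  fix S T :: "'a \<Rightarrow> 'a" assume S: "S \<in> bounded_ops" and T: "T \<in> bounded_ops"
  obtain C where C: "\<And>x. norm (S x + T x) \<le> norm x * C"
    using bounded_linear.bounded[OF bounded_linear_add[OF S[THEN bounded_linear_bounded_ops]
          T[THEN bounded_linear_bounded_ops]]] by blast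
  show "(\<lambda>x. S x + T x) \<in> bounded_ops"
    by (rule bounded_opsI[of _ C])
      (use C in \<open>auto simp: bounded_opsD[OF S] bounded_opsD[OF T] scaleC_add_right mult.commute\<close>)
qed

lift_definition uminus_bop :: "'a bop \<Rightarrow> 'a bop" is "\<lambda>S x. - S x"
  unfolding bounded_ops_def linear_op_def bounded_op_def
  by (auto simp: scaleC_minus_right)

definition minus_bop :: "'a bop \<Rightarrow> 'a bop \<Rightarrow> 'a bop" where
  "minus_bop a b = a + - b"

lift_definition times_bop :: "'a bop \<Rightarrow> 'a bop \<Rightarrow> 'a bop" is "\<lambda>S T x. S (T x)"
proof -
  fix S T :: "'a \<Rightarrow> 'a" assume S: "S \<in> bounded_ops" and T: "T \<in> bounded_ops"
  obtain C where C: "\<And>x. norm (S (T x)) \<le> norm x * C"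
    using bounded_linear.bounded[OF bounded_linear_compose[OF S[THEN bounded_linear_bounded_ops]
          T[THEN bounded_linear_bounded_ops]]] by blast
  show "(\<lambda>x. S (T x)) \<in> bounded_ops"
    by (rule bounded_opsI[of _ C])
      (use C in \<open>auto simp: bounded_opsD[OF S] bounded_opsD[OF T] mult.commute\<close>)
qed

lift_definition scaleR_bop :: "real \<Rightarrow> 'a bop \<Rightarrow> 'a bop" is "\<lambda>r S x. r *\<^sub>R S x"
proof -
  fix r :: real and S :: "'a \<Rightarrow> 'a" assume S: "S \<in> bounded_ops"
  obtain C where C: "\<And>x. norm (S x) \<le> C * norm x" using bounded_opsD(3)[OF S] by blast
  show "(\<lambda>x. r *\<^sub>R S x) \<in> bounded_ops"
  proof (rule bounded_opsI[of _ "\<bar>r\<bar> * C"])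
    show "norm (r *\<^sub>R S x) \<le> \<bar>r\<bar> * C * norm x" for x
      using mult_left_mono[OF C[of x], of "\<bar>r\<bar>"] by (simp add: mult.assoc)
  qed (simp_all add: bounded_opsD[OF S] scaleR_add_right scaleC_scaleR_commute)
qed

lemmas app_simps = zero_bop.rep_eq one_bop.rep_eq plus_bop.rep_eq uminus_bop.rep_eq
  times_bop.rep_eq scaleR_bop.rep_eq

instance
proof
  fix a b c :: "'a bop" and r s :: real
  show "a + b + c = a + (b + c)"
    by (rule bop_eqI) (simp add: app_simps add.assoc)
  show "a + b = b + a"
    by (rule bop_eqI) (simp add: app_simps add.commute)
  show "0 + a = a"
    by (rule bop_eqI) (simp add: app_simps)
  show "- a + a = 0"
    by (rule bop_eqI) (simp add: app_simps)
  show "a - b = a + - b"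
    by (rule bop_eqI) (simp add: app_simps minus_bop_def)
  show "(a + b) * c = a * c + b * c"
    by (rule bop_eqI) (simp add: app_simps)
  show "a * (b + c) = a * b + a * c"
    by (rule bop_eqI) (simp add: app_simps)
  show "a * b * c = a * (b * c)"
    by (rule bop_eqI) (simp add: app_simps)
  show "1 * a = a"
    by (rule bop_eqI) (simp add: app_simps)
  show "a * 1 = a"
    by (rule bop_eqI) (simp add: app_simps)
  show "r *\<^sub>R (a + b) = r *\<^sub>R a + r *\<^sub>R b"
    by (rule bop_eqI) (simp add: app_simps scaleR_add_right)
  show "(r + s) *\<^sub>R a = r *\<^sub>R a + s *\<^sub>R a"
    by (rule bop_eqI) (simp add: app_simps scaleR_add_left)
  show "r *\<^sub>R s *\<^sub>R a = (r * s) *\<^sub>R a"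
    by (rule bop_eqI) (simp add: app_simps)
  show "1 *\<^sub>R a = a"
    by (rule bop_eqI) (simp add: app_simps)
  show "r *\<^sub>R a * b = r *\<^sub>R (a * b)"
    by (rule bop_eqI) (simp add: app_simps)
  show "a * r *\<^sub>R b = r *\<^sub>R (a * b)"
    by (rule bop_eqI) (simp add: app_simps)
qed

end

lemma app_minus [simp]: "app (a - b) x = app a x - app b x"
  unfolding minus_bop_def by (simp only: app_simps diff_conv_add_uminus)

declare app_simps [simp]

text \<open>Complex scalars as central operators: multiplication of an operator by a scalar becomes a product
  in the ring.\<close>

lift_definition scal :: "complex \<Rightarrow> 'a::complex_hilbert bop" is "\<lambda>c x. c *\<^sub>C x"
  by (rule_tac bounded_opsI[of _ "cmod c" for c])
    (auto simp: scaleC_add_right scaleC_scaleC norm_scaleC mult.commute)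

declare scal.rep_eq [simp]

lemma scal_commute: "a * scal c = scal c * a"
  by (rule bop_eqI) simp

lemma scal_mult: "scal (c * d) = scal c * scal d"
  by (rule bop_eqI) (simp add: scaleC_scaleC)

lemma scal_of_real: "scal (complex_of_real r) = r *\<^sub>R 1"
  by (rule bop_eqI) (simp add: scaleR_scaleC)

lemma scal_uminus: "scal (- c) = - scal c"
  by (rule bop_eqI) (simp add: scaleC_minus_left)

subsection \<open>The adjoint\<close>

text \<open>The representation theorem is applied to the real inner product. The resulting real adjoint is
  complex linear because multiplication by \<open>c\<close> has the real adjoint multiplication by \<open>cnj c\<close>.\<close>

lemma adjoint_exists:
  fixes a :: "'a::complex_hilbert bop"
  shows "\<exists>b. \<forall>x y. inner (app a x) y = inner x (app b y)"
proof -
  have "\<exists>z. \<forall>x. inner (app a x) y = inner x z" for y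
  proof -
    have "bounded_linear (\<lambda>x. inner (app a x) y)"
      by (rule bounded_linear_compose[OF bounded_linear_inner_left bounded_linear_app])
    from riesz_representation[OF this] show ?thesis by metis
  qed
  then obtain g where g: "\<And>x y. inner (app a x) y = inner x (g y)" by metis
  have eqI: "u = v" if "\<And>x. inner x u = inner x v" for u v :: 'a
    using that by (metis vector_eq_rdot inner_commute)
  obtain C where C: "C > 0" "\<And>x. norm (app a x) \<le> C * norm x" by (rule app_bounded[of a]) blast
  have "g \<in> bounded_ops"
  proof (rule bounded_opsI[of _ C])
    fix x y :: 'a and c :: complex
    show "g (x + y) = g x + g y"
      by (rule eqI) (simp add: g[symmetric] inner_add_right)
    show "g (c *\<^sub>C x) = c *\<^sub>C g x"
    proof (rule eqI)
      fix z
      have "inner z (c *\<^sub>C g x) = inner (cnj c *\<^sub>C z) (g x)" by (simp add: inner_scaleC_left)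
      then show "inner z (g (c *\<^sub>C x)) = inner z (c *\<^sub>C g x)"
        by (simp add: g[symmetric] inner_scaleC_left)
    qed
    have "(norm (g x))\<^sup>2 = inner (app a (g x)) x"
      by (simp add: g power2_norm_eq_inner)
    also have "\<dots> \<le> C * norm (g x) * norm x"
      using norm_cauchy_schwarz[of "app a (g x)" x] mult_right_mono[OF C(2)[of "g x"], of "norm x"]
      by simp
    finally have "norm (g x) * norm (g x) \<le> norm (g x) * (C * norm x)"
      by (simp add: power2_eq_square mult.commute mult.left_commute)
    then show "norm (g x) \<le> C * norm x"
      using C(1) by (cases "norm (g x) = 0") (auto simp: mult_le_cancel_left)
  qed
  then show ?thesis using g by (metis Bop_inverse)
qed

definition star :: "'a::complex_hilbert bop \<Rightarrow> 'a bop" where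
  "star a = (SOME b. \<forall>x y. inner (app a x) y = inner x (app b y))"

lemma star_right: "inner (app a x) y = inner x (app (star a) y)"
  using someI_ex[OF adjoint_exists[of a]] unfolding star_def by blast

lemma star_left: "inner (app (star a) x) y = inner x (app a y)"
  by (metis star_right inner_commute)

lemma star_unique: "(\<And>x y. inner (app a x) y = inner x (app b y)) \<Longrightarrow> star a = b"
  by (rule bop_eqI) (metis star_right vector_eq_rdot inner_commute)

lemma star_star [simp]: "star (star a) = a"
  by (rule star_unique) (rule star_left)

lemma star_simps [simp]:
  "star (a + b) = star a + star b" "star (a - b) = star a - star b"
  "star (a * b) = star b * star a" "star (r *\<^sub>R a) = r *\<^sub>R star a" "star 0 = 0" "star 1 = 1"
  "star (scal c) = scal (cnj c)"
  by (rule star_unique, simp add: star_right inner_simps inner_scaleC_left)+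

lemma adj_app: "adj UNIV (app a) = app (star a)"
proof -
  have iff: "(\<forall>x. cinner (app a x) y = cinner x z) \<longleftrightarrow> z = app (star a) y" for y z
  proof
    assume "\<forall>x. cinner (app a x) y = cinner x z"
    then have "inner x (app (star a) y) = inner x z" for x
      by (metis Re_cinner star_right)
    then show "z = app (star a) y" by (metis vector_eq_rdot inner_commute)
  next
    assume "z = app (star a) y"
    then show "\<forall>x. cinner (app a x) y = cinner x z"
      by (simp add: cinner_eq_inner star_right)
  qed
  have dom: "adj_dom UNIV (app a) = UNIV"
    unfolding adj_dom_def by (simp add: iff)
  show ?thesis
    unfolding adj_def dom ball_UNIV iff by (simp add: restrict_def)
qed

subsection \<open>Positive operators\<close>

definition pos :: "'a::complex_hilbert bop \<Rightarrow> bool" where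
  "pos a \<longleftrightarrow> star a = a \<and> (\<forall>x. 0 \<le> inner (app a x) x)"

lemma posD: "pos a \<Longrightarrow> star a = a" "pos a \<Longrightarrow> 0 \<le> inner (app a x) x"
  by (auto simp: pos_def)

lemma pos_add: "pos a \<Longrightarrow> pos b \<Longrightarrow> pos (a + b)"
  by (simp add: pos_def inner_add_left)

lemma pos_scaleR: "pos a \<Longrightarrow> 0 \<le> r \<Longrightarrow> pos (r *\<^sub>R a)"
  by (simp add: pos_def)

lemma pos_conj: "pos a \<Longrightarrow> pos (star b * a * b)"
  by (simp add: pos_def star_left mult.assoc)

lemma pos_zero [simp]: "pos 0" by (simp add: pos_def)
lemma pos_one [simp]: "pos 1" by (simp add: pos_def)

lemma pos_star_mult [simp]: "pos (star a * a)" "pos (a * star a)"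
  using pos_conj[OF pos_one, of a] pos_conj[OF pos_one, of "star a"] by simp_all

text \<open>A form with real values on the diagonal is symmetric: polarize at \<open>x + \<i> y\<close>. Conversely, a
  symmetric complex linear operator has real diagonal values because \<open>\<i>\<close> is skew.\<close>

lemma positive_op_app: "positive_op (app a) \<longleftrightarrow> pos a"
proof
  assume "positive_op (app a)"
  then have nn: "cinner (app a x) x \<in> \<real>\<^sub>\<ge>\<^sub>0" for x by (simp add: positive_op_def)
  have im: "Im (cinner (app a x) x) = 0" and re: "0 \<le> inner (app a x) x" for x
    using nn[of x] by (auto simp: complex_nonneg_Reals_iff Re_cinner)
  have zero: "inner (app a x) (\<i> *\<^sub>C x) = 0" for x
    using im[of x] by (simp add: cinner_eq_inner)
  have "inner (app a x) y = inner x (app a y)" for x y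
    using zero[of "x + \<i> *\<^sub>C y"] zero[of x] zero[of y]
    by (simp add: inner_simps scaleC_add_right scaleC_scaleC inner_scaleC_left scaleC_minus_left
        inner_commute[of x])
  then have "star a = a" by (rule star_unique)
  with re show "pos a" by (simp add: pos_def)
next
  assume a: "pos a"
  have "inner (app a x) (\<i> *\<^sub>C x) = 0" for x
  proof -
    have "inner (app a x) (\<i> *\<^sub>C x) = inner x (\<i> *\<^sub>C app a x)"
      using star_right[of a x "\<i> *\<^sub>C x"] posD(1)[OF a] by simp
    also have "\<dots> = - inner (app a x) (\<i> *\<^sub>C x)"
      by (simp add: inner_commute[of x "\<i> *\<^sub>C app a x"] inner_scaleC_left scaleC_minus_left)
    finally show ?thesis by simp
  qed
  then show "positive_op (app a)"
    using posD(2)[OF a] app[of a]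
    by (auto simp: positive_op_def cinner_eq_inner complex_nonneg_Reals_iff)
qed

section \<open>Square roots of positive operators\<close>

text \<open>The form of \<open>a\<close> is nonnegative at \<open>C x - a x\<close>; expanding it gives the bound. It is the
  Cauchy-Schwarz inequality for the form, applied to \<open>x\<close> and \<open>a x\<close>.\<close>

lemma pos_norm_le:
  assumes a: "pos a" and C: "C > 0" "\<And>x. norm (app a x) \<le> C * norm x"
  shows "(norm (app a x))\<^sup>2 \<le> C * inner (app a x) x"
proof -
  have sym: "inner (app a u) v = inner u (app a v)" for u v
    using star_right[of a u v] posD(1)[OF a] by simp
  define y where "y = app a x"
  have "inner (app a y) y \<le> C * (norm y)\<^sup>2"
    using norm_cauchy_schwarz[of "app a y" y] mult_right_mono[OF C(2)[of y], of "norm y"]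
    by (simp add: power2_eq_square mult.assoc)
  moreover have "0 \<le> inner (app a (C *\<^sub>R x - y)) (C *\<^sub>R x - y)"
    by (rule posD(2)[OF a])
  moreover have "inner (app a (C *\<^sub>R x - y)) (C *\<^sub>R x - y)
      = C * C * inner y x - 2 * C * (norm y)\<^sup>2 + inner (app a y) y"
    using sym[of y x] unfolding power2_norm_eq_inner
    by (simp add: inner_simps y_def[symmetric] inner_commute[of x y] algebra_simps)
  ultimately have "0 \<le> C * (C * inner y x - (norm y)\<^sup>2)"
    by (simp add: algebra_simps)
  then show ?thesis
    using C(1) by (simp add: zero_le_mult_iff y_def)
qed

lemma pos_kernel:
  assumes "pos a" "inner (app a x) x = 0"
  shows "app a x = 0"
proof -
  obtain C where "C > 0" "\<And>x. norm (app a x) \<le> C * norm x" by (rule app_bounded[of a]) blast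
  from pos_norm_le[OF assms(1) this, of x] assms(2) show ?thesis by simp
qed

lemma bop_pointwise_limit:
  fixes r :: "nat \<Rightarrow> 'a::complex_hilbert bop"
  assumes cau: "\<And>x. Cauchy (\<lambda>n. app (r n) x)" and bd: "\<And>n x. norm (app (r n) x) \<le> C * norm x"
  obtains g where "\<And>x. (\<lambda>n. app (r n) x) \<longlonglongrightarrow> app g x"
proof -
  have "\<exists>l. (\<lambda>n. app (r n) x) \<longlonglongrightarrow> l" for x
    using cau[of x] Cauchy_convergent convergent_def by blast
  then obtain h where h: "\<And>x. (\<lambda>n. app (r n) x) \<longlonglongrightarrow> h x" by metis
  have "h \<in> bounded_ops"
  proof (rule bounded_opsI[of _ C])
    fix x y :: 'a and c :: complex
    show "h (x + y) = h x + h y"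
      using tendsto_add[OF h[of x] h[of y]] h[of "x + y"] by (simp add: LIMSEQ_unique)
    have "(\<lambda>n. app (scal c) (app (r n) x)) \<longlonglongrightarrow> app (scal c) (h x)"
      by (rule bounded_linear.tendsto[OF bounded_linear_app h])
    then show "h (c *\<^sub>C x) = c *\<^sub>C h x"
      using h[of "c *\<^sub>C x"] by (simp add: LIMSEQ_unique)
    show "norm (h x) \<le> C * norm x"
      using tendsto_norm[OF h[of x]] bd by (intro LIMSEQ_le_const2[of "\<lambda>n. norm (app (r n) x)"]) auto
  qed
  then have "app (Bop h) = h" by (rule Bop_inverse)
  with h that[of "Bop h"] show ?thesis by simp
qed

text \<open>A solution \<open>g\<close> of \<open>g = (b + g\<^sup>2) / 2\<close> satisfies \<open>(1 - g)\<^sup>2 = 1 - b\<close>, so iterating the right-hand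
  side produces square roots of \<open>1 - b\<close>. The iterates are polynomials in \<open>b\<close>.\<close>

primrec sqrt_iter :: "'a::complex_hilbert bop \<Rightarrow> nat \<Rightarrow> 'a bop" where
  "sqrt_iter b 0 = 0"
| "sqrt_iter b (Suc n) = (1/2) *\<^sub>R (b + sqrt_iter b n * sqrt_iter b n)"

text \<open>The same iteration for the number \<open>b = 1\<close>. It increases to \<open>1\<close>, and for a contraction \<open>b\<close> its
  increments dominate those of the operator iteration, so the latter converges.\<close>

primrec sqrt_bound :: "nat \<Rightarrow> real" where
  "sqrt_bound 0 = 0"
| "sqrt_bound (Suc n) = (1 + (sqrt_bound n)\<^sup>2) / 2"

lemma sqrt_bound_range: "0 \<le> sqrt_bound n \<and> sqrt_bound n \<le> 1"
  by (induction n) (auto simp: power_le_one)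

lemma sqrt_bound_mono: "sqrt_bound n \<le> sqrt_bound (Suc n)"
proof -
  have "0 \<le> (sqrt_bound n - 1)\<^sup>2" by simp
  then show ?thesis by (simp add: power2_diff)
qed

lemma sqrt_iter_commute: "c * b = b * c \<Longrightarrow> c * sqrt_iter b n = sqrt_iter b n * c"
proof (induction n)
  case (Suc n)
  then have "c * (sqrt_iter b n * sqrt_iter b n) = (sqrt_iter b n * sqrt_iter b n) * c"
    by (metis mult.assoc)
  with Suc.prems show ?case by (simp add: distrib_left distrib_right)
qed simp

lemma star_sqrt_iter: "star b = b \<Longrightarrow> star (sqrt_iter b n) = sqrt_iter b n"
  by (induction n) auto

context
  fixes b :: "'a::complex_hilbert bop"
  assumes contraction: "\<And>x. norm (app b x) \<le> norm x"
begin

lemma norm_sqrt_iter: "norm (app (sqrt_iter b n) x) \<le> sqrt_bound n * norm x"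
proof (induction n arbitrary: x)
  case (Suc n)
  let ?r = "app (sqrt_iter b n)"
  have "norm (?r (?r x)) \<le> sqrt_bound n * (sqrt_bound n * norm x)"
    using Suc[of "?r x"] mult_left_mono[OF Suc[of x], of "sqrt_bound n"] sqrt_bound_range[of n]
    by linarith
  then have "norm (app b x + ?r (?r x)) \<le> norm x + sqrt_bound n * (sqrt_bound n * norm x)"
    using norm_triangle_ineq[of "app b x" "?r (?r x)"] contraction[of x] by linarith
  then have "norm ((1/2) *\<^sub>R (app b x + ?r (?r x)))
      \<le> (1/2) * (norm x + sqrt_bound n * (sqrt_bound n * norm x))"
    by simp
  also have "\<dots> = sqrt_bound (Suc n) * norm x"
    by (simp add: power2_eq_square algebra_simps)
  finally show ?case by simp
qed simp

lemma norm_sqrt_iter_le: "norm (app (sqrt_iter b n) x) \<le> norm x"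
  using norm_sqrt_iter[of n x] mult_right_mono[of "sqrt_bound n" 1 "norm x"] sqrt_bound_range[of n]
  by simp

text \<open>Consecutive iterates \<open>p, q\<close> commute, so the next increment is \<open>(p + q) (p - q) / 2\<close>; the scalar
  iteration obeys the same recursion.\<close>

lemma norm_sqrt_iter_step:
  "norm (app (sqrt_iter b (Suc n)) x - app (sqrt_iter b n) x)
    \<le> (sqrt_bound (Suc n) - sqrt_bound n) * norm x"
proof (induction n arbitrary: x)
  case 0
  show ?case using contraction[of x] by simp
next
  case (Suc n)
  let ?p = "sqrt_iter b (Suc n)" and ?q = "sqrt_iter b n"
  let ?s = "sqrt_bound (Suc n)" and ?t = "sqrt_bound n"
  have comm: "?p * ?q = ?q * ?p"
    by (rule sqrt_iter_commute) (rule sqrt_iter_commute[symmetric], simp)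
  define y where "y = app ?p x - app ?q x"
  have y: "norm y \<le> (?s - ?t) * norm x" unfolding y_def by (rule Suc)
  have "sqrt_iter b (Suc (Suc n)) - ?p = (1/2) *\<^sub>R ((?p + ?q) * (?p - ?q))"
    unfolding sqrt_iter.simps(2)[of b "Suc n"]
    by (subst (3) sqrt_iter.simps(2))
      (simp add: algebra_simps comm del: sqrt_iter.simps)
  then have "app (sqrt_iter b (Suc (Suc n))) x - app ?p x = (1/2) *\<^sub>R (app ?p y + app ?q y)"
    by (metis app_minus plus_bop.rep_eq scaleR_bop.rep_eq times_bop.rep_eq y_def)
  moreover have "norm (app ?p y + app ?q y) \<le> (?s + ?t) * norm y"
    using norm_sqrt_iter[of "Suc n" y] norm_sqrt_iter[of n y]
      norm_triangle_ineq[of "app ?p y" "app ?q y"] by (simp add: distrib_right del: sqrt_iter.simps sqrt_bound.simps)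
  moreover have "(?s + ?t) * norm y \<le> (?s + ?t) * ((?s - ?t) * norm x)"
    by (rule mult_left_mono[OF y]) (use sqrt_bound_range[of n] sqrt_bound_range[of "Suc n"] in linarith)
  ultimately have "norm (app (sqrt_iter b (Suc (Suc n))) x - app ?p x)
      \<le> (1/2) * ((?s + ?t) * ((?s - ?t) * norm x))"
    by (simp del: sqrt_iter.simps sqrt_bound.simps)
  also have "\<dots> = ((1 + ?s\<^sup>2) / 2 - (1 + ?t\<^sup>2) / 2) * norm x"
    by (simp add: power2_eq_square algebra_simps del: sqrt_bound.simps)
  finally show ?case by (simp only: sqrt_bound.simps)
qed

lemma norm_sqrt_iter_diff:
  assumes "n \<le> m"
  shows "norm (app (sqrt_iter b m) x - app (sqrt_iter b n) x) \<le> (sqrt_bound m - sqrt_bound n) * norm x"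
  using assms
proof (induction m rule: dec_induct)
  case (step m)
  have "app (sqrt_iter b (Suc m)) x - app (sqrt_iter b n) x =
      (app (sqrt_iter b (Suc m)) x - app (sqrt_iter b m) x)
      + (app (sqrt_iter b m) x - app (sqrt_iter b n) x)"
    by simp
  then show ?case
    using norm_triangle_ineq[of "app (sqrt_iter b (Suc m)) x - app (sqrt_iter b m) x"
        "app (sqrt_iter b m) x - app (sqrt_iter b n) x"] norm_sqrt_iter_step[of m x] step.IH
    by (simp add: left_diff_distrib del: sqrt_iter.simps sqrt_bound.simps)
qed simp

lemma Cauchy_sqrt_iter: "Cauchy (\<lambda>n. app (sqrt_iter b n) x)"
proof (rule metric_CauchyI)
  fix e :: real assume e: "e > 0"
  have "incseq sqrt_bound" by (rule incseq_SucI) (rule sqrt_bound_mono)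
  then have "convergent sqrt_bound"
    using sqrt_bound_range by (metis incseq_convergent convergent_def)
  then have "Cauchy sqrt_bound" by (rule convergent_Cauchy)
  moreover have "0 < e / (norm x + 1)" using e by (simp add: add_nonneg_pos)
  ultimately obtain N where N: "\<And>m n. m \<ge> N \<Longrightarrow> n \<ge> N \<Longrightarrow>
      dist (sqrt_bound m) (sqrt_bound n) < e / (norm x + 1)"
    by (meson metric_CauchyD)
  have lt: "dist (app (sqrt_iter b m) x) (app (sqrt_iter b n) x) < e"
    if "m \<ge> N" "n \<ge> N" "n \<le> m" for m n
  proof -
    have "sqrt_bound m - sqrt_bound n < e / (norm x + 1)"
      using N[OF that(1,2)] by (simp add: dist_real_def)
    then have "(sqrt_bound m - sqrt_bound n) * (norm x + 1) < e"
      by (simp add: pos_less_divide_eq add_nonneg_pos)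
    moreover have "sqrt_bound n \<le> sqrt_bound m"
      using \<open>incseq sqrt_bound\<close> that(3) by (simp add: incseqD)
    ultimately show ?thesis
      using norm_sqrt_iter_diff[OF that(3), of x] by (simp add: dist_norm distrib_left)
  qed
  then show "\<exists>N. \<forall>m\<ge>N. \<forall>n\<ge>N. dist (app (sqrt_iter b m) x) (app (sqrt_iter b n) x) < e"
    by (metis dist_commute nat_le_linear)
qed

lemma sqrt_limit:
  assumes "star b = b"
  obtains g where "g = (1/2) *\<^sub>R (b + g * g)" "star g = g" "\<And>x. norm (app g x) \<le> norm x"
    "\<And>c. c * b = b * c \<Longrightarrow> c * g = g * c"
proof -
  let ?r = "\<lambda>n. app (sqrt_iter b n)"
  obtain g where g: "\<And>x. (\<lambda>n. ?r n x) \<longlonglongrightarrow> app g x"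
    using bop_pointwise_limit[of "sqrt_iter b" 1] Cauchy_sqrt_iter norm_sqrt_iter_le by auto
  have gg: "(\<lambda>n. ?r n (?r n x)) \<longlonglongrightarrow> app g (app g x)" for x
  proof -
    have "(\<lambda>n. ?r n x - app g x) \<longlonglongrightarrow> 0" by (rule LIM_zero[OF g])
    then have "(\<lambda>n. ?r n (?r n x - app g x)) \<longlonglongrightarrow> 0"
      by (rule Lim_null_comparison[OF always_eventually tendsto_norm_zero, rotated])
        (simp only: norm_sqrt_iter_le simp_thms)
    from tendsto_add[OF this g[of "app g x"]] show ?thesis by simp
  qed
  show ?thesis
  proof (rule that)
    show "g = (1/2) *\<^sub>R (b + g * g)"
    proof (rule bop_eqI)
      fix x
      have "(\<lambda>n. ?r (Suc n) x) \<longlonglongrightarrow> (1/2) *\<^sub>R (app b x + app g (app g x))"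
        by (simp del: scaleR_half_double) (intro tendsto_intros gg)
      moreover have "(\<lambda>n. ?r (Suc n) x) \<longlonglongrightarrow> app g x" using g[of x] by (rule LIMSEQ_Suc)
      ultimately show "app g x = app ((1/2) *\<^sub>R (b + g * g)) x"
        using LIMSEQ_unique by fastforce
    qed
    show "star g = g"
    proof (rule star_unique)
      fix x y
      have "(\<lambda>n. inner (?r n x) y) \<longlonglongrightarrow> inner (app g x) y" by (intro tendsto_intros g)
      moreover have "(\<lambda>n. inner x (?r n y)) \<longlonglongrightarrow> inner x (app g y)" by (intro tendsto_intros g)
      moreover have "inner (?r n x) y = inner x (?r n y)" for n
        using star_right[of "sqrt_iter b n"] star_sqrt_iter[OF assms] by simp
      ultimately show "inner (app g x) y = inner x (app g y)" by (simp add: LIMSEQ_unique)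
    qed
    show "norm (app g x) \<le> norm x" for x
      using tendsto_norm[OF g[of x]] norm_sqrt_iter_le
      by (intro LIMSEQ_le_const2[of "\<lambda>n. norm (?r n x)"]) auto
    show "c * g = g * c" if c: "c * b = b * c" for c
    proof (rule bop_eqI)
      fix x
      have "(\<lambda>n. app c (?r n x)) \<longlonglongrightarrow> app c (app g x)"
        by (rule bounded_linear.tendsto[OF bounded_linear_app g])
      moreover have "app c (?r n x) = ?r n (app c x)" for n
        using sqrt_iter_commute[OF c, of n] by (metis times_bop.rep_eq)
      ultimately show "app (c * g) x = app (g * c) x"
        using g[of "app c x"] by (simp add: LIMSEQ_unique)
    qed
  qed
qed

end

text \<open>After scaling \<open>a\<close> to a contraction, \<open>1 - a\<close> is one as well by
  the estimate of \<open>\<parallel>a x\<parallel>\<close> by the form of \<open>a\<close>, and the limit of the iteration applies. The root inherits from the polynomials in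
  \<open>a\<close> that it commutes with everything that commutes with \<open>a\<close>.\<close>

lemma pos_sqrt_exists:
  assumes a: "pos a"
  obtains q where "pos q" "q * q = a" "\<And>c. c * a = a * c \<Longrightarrow> c * q = q * c"
proof -
  obtain C where C: "C > 0" "\<And>x. norm (app a x) \<le> C * norm x" by (rule app_bounded[of a]) blast
  define b where "b = 1 - (1/C) *\<^sub>R a"
  have "norm (app b x) \<le> norm x" for x
  proof -
    have "(norm (app b x))\<^sup>2 = (norm x)\<^sup>2 - 2 * (inner (app a x) x / C) + (norm (app a x))\<^sup>2 / C\<^sup>2"
    proof -
      have "app b x = x - (1/C) *\<^sub>R app a x" by (simp add: b_def)
      then show ?thesis
        unfolding power2_norm_eq_inner
        by (simp add: inner_diff_left inner_diff_right inner_commute[of x "app a x"]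
            power2_eq_square diff_divide_distrib)
    qed
    moreover have "(norm (app a x))\<^sup>2 / C\<^sup>2 \<le> inner (app a x) x / C"
      using divide_right_mono[OF pos_norm_le[OF a C, of x], of "C\<^sup>2"] C(1)
      by (simp add: power2_eq_square)
    moreover have "0 \<le> inner (app a x) x / C" using posD(2)[OF a, of x] C(1) by simp
    ultimately have "(norm (app b x))\<^sup>2 \<le> (norm x)\<^sup>2" by linarith
    then show ?thesis by (simp add: power2_le_iff_abs_le)
  qed
  moreover have "star b = b" by (simp add: b_def posD[OF a])
  ultimately obtain g where g: "g = (1/2) *\<^sub>R (b + g * g)" "star g = g" "\<And>x. norm (app g x) \<le> norm x"
    "\<And>c. c * b = b * c \<Longrightarrow> c * g = g * c" by (rule sqrt_limit) blast
  define q where "q = sqrt C *\<^sub>R (1 - g)"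
  show ?thesis
  proof (rule that[of q])
    have "inner (app g x) x \<le> inner x x" for x
      using norm_cauchy_schwarz[of "app g x" x] mult_right_mono[OF g(3)[of x], of "norm x"]
      by (simp add: power2_norm_eq_inner[symmetric] power2_eq_square)
    then show "pos q"
      using C(1) unfolding q_def by (intro pos_scaleR) (auto simp: pos_def g(2) inner_diff_left)
    have "2 *\<^sub>R g = b + g * g" using arg_cong[OF g(1), of "\<lambda>u. 2 *\<^sub>R u"] by simp
    then have "g + g = b + g * g" by (simp add: scaleR_2)
    then have "1 - b = 1 - g - g + g * g" by (simp add: algebra_simps)
    then have "(1 - g) * (1 - g) = (1/C) *\<^sub>R a" by (simp add: b_def algebra_simps)
    then show "q * q = a" using C(1) by (simp add: q_def)
    fix c assume "c * a = a * c"
    then have "c * b = b * c" by (simp add: b_def right_diff_distrib left_diff_distrib)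
    from g(4)[OF this] show "c * q = q * c" by (simp add: q_def right_diff_distrib left_diff_distrib)
  qed
qed

text \<open>The roots commute, so \<open>(p + q) (p - q) = 0\<close>. On the range of \<open>p - q\<close> the forms of \<open>p\<close> and \<open>q\<close>
  are nonnegative with sum zero, hence both operators vanish there, and \<open>(p - q)\<^sup>2 = 0\<close>.\<close>

lemma pos_sqrt_unique:
  assumes p: "pos p" and q: "pos q" and eq: "p * p = q * q"
    and comm: "\<And>c. c * (q * q) = (q * q) * c \<Longrightarrow> c * q = q * c"
  shows "p = q"
proof (rule bop_eqI)
  fix x
  have pq: "p * q = q * p" by (rule comm) (simp add: eq[symmetric] mult.assoc)
  define y where "y = app (p - q) x"
  have "app (p + q) y = 0"
  proof -
    have "(p + q) * (p - q) = 0" by (simp add: algebra_simps eq pq)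
    then show ?thesis by (metis times_bop.rep_eq y_def zero_bop.rep_eq)
  qed
  then have "inner (app p y) y + inner (app q y) y = 0"
    by (metis inner_add_left inner_zero_left plus_bop.rep_eq)
  with posD(2)[OF p, of y] posD(2)[OF q, of y]
  have "inner (app p y) y = 0" "inner (app q y) y = 0" by linarith+
  then have "app p y = 0" "app q y = 0" using p q pos_kernel by auto
  then have "app (p - q) y = 0" by simp
  moreover have "inner (app (p - q) x) y = inner x (app (p - q) y)"
    using star_left[of "p - q" x y] posD(1)[OF p] posD(1)[OF q] by simp
  ultimately have "inner y y = 0" by (simp only: y_def[symmetric] inner_zero_right)
  then show "app p x = app q x" by (simp add: y_def)
qed

text \<open>By existence and uniqueness of roots the modulus is well defined, and from here on
  only its square \<open>x\<^sup>* x\<close> matters.\<close>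

lemma op_abs_square: "op_abs (app x) \<circ> op_abs (app x) = app (star x * x)"
proof -
  have "pos (star x * x)" by simp
  then obtain q where q: "pos q" "q * q = star x * x"
    "\<And>c. c * (star x * x) = star x * x * c \<Longrightarrow> c * q = q * c" by (rule pos_sqrt_exists) blast
  have prod: "app u \<circ> app v = app (u * v)" for u v :: "'a bop"
    by (rule ext) simp
  have "op_abs (app x) = app q"
    unfolding op_abs_def adj_app prod
  proof (rule the_equality)
    show "positive_op (app q) \<and> app q \<circ> app q = app (star x * x)"
      by (simp only: positive_op_app prod q(1,2) simp_thms)
    fix p assume p: "positive_op p \<and> p \<circ> p = app (star x * x)"
    then have "p \<in> bounded_ops" by (simp add: positive_op_def)
    then obtain p' where p': "p = app p'" by (metis Bop_inverse)
    have pp: "pos p'" using p by (simp add: p' positive_op_app)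
    have eq: "p' * p' = q * q"
      using p unfolding p' prod app_inject q(2) by blast
    have comm: "c * q = q * c" if "c * (q * q) = q * q * c" for c
      using that unfolding q(2) by (rule q(3))
    have "p' = q" by (rule pos_sqrt_unique[OF pp q(1) eq comm])
    then show "p = app q" by (simp add: p')
  qed
  then show ?thesis unfolding prod[symmetric] q(2)[symmetric] by simp
qed

section \<open>A trace on a von Neumann algebra\<close>

lemma op_UNIV_app:
  "op_add UNIV (app a) (app b) = app (a + b)"
  "op_diff UNIV (app a) (app b) = app (a - b)"
  "op_scale UNIV c (app a) = app (scal c * a)"
  by (auto simp: op_add_def op_diff_def op_scale_def)

lemma comp_app: "app a \<circ> app b = app (a * b)"
  by (rule ext) simp

lemma op_le_app: "op_le (app a) (app b) \<longleftrightarrow> pos (b - a)"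
  unfolding op_le_def op_UNIV_app positive_op_app ..

lemma bounded_ops_eq: "bounded_ops = range app"
  by (rule type_definition.Rep_range[OF type_definition_bop, symmetric])

text \<open>With a root \<open>q\<close> of \<open>b\<close> that commutes with \<open>a\<close>, the product is \<open>q a q\<close>.\<close>

lemma pos_mult:
  assumes "pos a" "pos b" "a * b = b * a"
  shows "pos (a * b)"
proof -
  obtain q where q: "pos q" "q * q = b" "\<And>c. c * b = b * c \<Longrightarrow> c * q = q * c"
    by (rule pos_sqrt_exists[OF assms(2)]) blast
  have "a * b = star q * a * q"
    using q(3)[OF assms(3)] by (simp add: posD(1)[OF q(1)] q(2)[symmetric] mult.assoc[symmetric])
  then show ?thesis using pos_conj[OF assms(1), of q] by simp
qed

text \<open>The optimal choice is \<open>t = sqrt (a / b)\<close>. Adding \<open>1 / (n + 1)\<close> to both numbers keeps it defined when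
  one of them is zero.\<close>

lemma mean_inequality_limit:
  fixes a b k :: real
  assumes "0 \<le> a" "0 \<le> b" and k: "\<And>t. 0 < t \<Longrightarrow> k \<le> a / t + t * b"
  shows "k \<le> 2 * (sqrt a * sqrt b)"
proof -
  have bound: "k \<le> 2 * (sqrt (a + 1 / Suc n) * sqrt (b + 1 / Suc n))" for n
  proof -
    define u where "u = sqrt (a + 1 / Suc n)"
    define v where "v = sqrt (b + 1 / Suc n)"
    have uv: "u > 0" "v > 0" using assms(1,2) by (simp_all add: u_def v_def add_nonneg_pos)
    have "a \<le> u\<^sup>2" "b \<le> v\<^sup>2" using assms(1,2) by (simp_all add: u_def v_def)
    \<comment> \<open>Take \<open>t = u / v\<close>, the optimum for the enlarged numbers.\<close>
    then have "a / (u / v) + (u / v) * b \<le> u\<^sup>2 / (u / v) + (u / v) * v\<^sup>2"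
      using uv by (intro add_mono divide_right_mono mult_left_mono) auto
    also have "\<dots> = 2 * (u * v)" using uv by (simp add: power2_eq_square)
    finally show ?thesis using k[of "u / v"] uv by (simp add: u_def v_def)
  qed
  have "(\<lambda>n. 2 * (sqrt (a + 1 / real (Suc n)) * sqrt (b + 1 / real (Suc n))))
      \<longlonglongrightarrow> 2 * (sqrt (a + 0) * sqrt (b + 0))"
    by (intro tendsto_intros LIMSEQ_Suc[OF lim_1_over_n])
  from LIMSEQ_le_const[OF this] bound show ?thesis by simp
qed

locale traced_algebra =
  fixes M :: "('k::complex_hilbert \<Rightarrow> 'k) set" and \<rho> :: "('k \<Rightarrow> 'k) \<Rightarrow> ennreal"
  assumes vN: "von_neumann_algebra M" and trace: "trace_on M \<rho>" and normal: "normal_trace M \<rho>"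
begin

definition mem :: "'k bop \<Rightarrow> bool" where
  "mem a \<longleftrightarrow> app a \<in> M"

definition tr :: "'k bop \<Rightarrow> ennreal" where
  "tr a = \<rho> (app a)"

lemma M_eq: "M = {app a | a. mem a}"
  using vN bounded_ops_eq by (fastforce simp: von_neumann_algebra_def mem_def)

text \<open>In the form of the double commutant property, membership in \<open>M\<close> is a commutation relation, from
  which all closure properties of \<open>M\<close> follow.\<close>

lemma mem_iff: "mem a \<longleftrightarrow> (\<forall>c. app c \<in> commutant M \<longrightarrow> a * c = c * a)"
proof -
  have "app a \<in> M \<longleftrightarrow> app a \<in> commutant (commutant M)"
    using vN by (simp add: von_neumann_algebra_def)
  also have "\<dots> \<longleftrightarrow> (\<forall>s\<in>commutant M. app a \<circ> s = s \<circ> app a)"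
    unfolding commutant_def[of "commutant M"] using app[of a] by blast
  also have "\<dots> \<longleftrightarrow> (\<forall>c. app c \<in> commutant M \<longrightarrow> app a \<circ> app c = app c \<circ> app a)"
  proof -
    have "\<exists>c. s = app c" if "s \<in> commutant M" for s
      using that Bop_inverse[of s] by (auto simp: commutant_def intro!: exI[of _ "Bop s"])
    then show ?thesis by metis
  qed
  finally show ?thesis unfolding mem_def comp_app app_inject .
qed

lemma mem_commutes: "mem a \<Longrightarrow> app c \<in> commutant M \<Longrightarrow> a * c = c * a"
  using mem_iff by blast

lemma mem_add [simp]: "mem a \<Longrightarrow> mem b \<Longrightarrow> mem (a + b)"
  unfolding mem_iff by (simp add: distrib_left distrib_right)

lemma mem_diff [simp]: "mem a \<Longrightarrow> mem b \<Longrightarrow> mem (a - b)"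
  unfolding mem_iff by (simp add: left_diff_distrib right_diff_distrib)

lemma mem_mult [simp]: "mem a \<Longrightarrow> mem b \<Longrightarrow> mem (a * b)"
  unfolding mem_iff by (metis mult.assoc)

lemma mem_scaleR [simp]: "mem a \<Longrightarrow> mem (r *\<^sub>R a)"
  unfolding mem_iff by simp

lemma mem_zero [simp]: "mem 0" and mem_one [simp]: "mem 1"
  by (simp_all add: mem_iff)

lemma mem_scal [simp]: "mem (scal c)"
  by (simp add: mem_iff scal_commute)

lemma mem_power [simp]: "mem a \<Longrightarrow> mem (a ^ n)"
  by (induction n) simp_all

lemma mem_star [simp]: "mem a \<Longrightarrow> mem (star a)"
  using vN by (metis mem_def adj_app von_neumann_algebra_def)

lemma mem_sqrt:
  assumes "mem a" "pos a"
  obtains q where "pos q" "q * q = a" "mem q"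
proof -
  obtain q where q: "pos q" "q * q = a" "\<And>c. c * a = a * c \<Longrightarrow> c * q = q * c"
    by (rule pos_sqrt_exists[OF assms(2)]) blast
  have "mem q"
    unfolding mem_iff using q(3) mem_commutes[OF assms(1)] by metis
  with q that show ?thesis by blast
qed

lemma positive_part_app: "app a \<in> positive_part M \<longleftrightarrow> mem a \<and> pos a"
  by (simp add: positive_part_def mem_def positive_op_app)

lemma tr_add: "mem a \<Longrightarrow> pos a \<Longrightarrow> mem b \<Longrightarrow> pos b \<Longrightarrow> tr (a + b) = tr a + tr b"
  using trace unfolding trace_on_def tr_def op_UNIV_app(1)[symmetric]
  by (simp add: positive_part_app)

lemma tr_scaleR:
  assumes "mem a" "pos a" "0 \<le> r"
  shows "tr (r *\<^sub>R a) = ennreal r * tr a"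
proof -
  have "app a \<in> positive_part M" using assms by (simp add: positive_part_app)
  then have "\<rho> (op_scale UNIV (complex_of_real r) (app a)) = ennreal r * \<rho> (app a)"
    using trace assms(3) unfolding trace_on_def by blast
  then show ?thesis unfolding op_UNIV_app(3) by (simp add: tr_def scal_of_real)
qed

lemma tr_star_commute: "mem a \<Longrightarrow> tr (star a * a) = tr (a * star a)"
  using trace unfolding trace_on_def tr_def mem_def comp_app[symmetric] adj_app[symmetric] by blast

lemma tr_mono: "mem a \<Longrightarrow> pos a \<Longrightarrow> mem b \<Longrightarrow> pos (b - a) \<Longrightarrow> tr a \<le> tr b"
  using tr_add[of a "b - a"] by simp

subsection \<open>The square-integrable ideal\<close>

definition J :: "'k bop \<Rightarrow> bool" where
  "J a \<longleftrightarrow> mem a \<and> tr (star a * a) < \<infinity>"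

definition sq :: "'k bop \<Rightarrow> real" where
  "sq a = enn2real (tr (star a * a))"

definition nrm :: "'k bop \<Rightarrow> real" where
  "nrm a = sqrt (sq a)"

lemma J_mem [simp]: "J a \<Longrightarrow> mem a" by (simp add: J_def)

lemma J2_app: "app a \<in> J2 M \<rho> \<longleftrightarrow> J a"
  unfolding J2_def J_def mem_def tr_def by (simp add: op_abs_square)

lemma J2_eq: "J2 M \<rho> = {app a | a. J a}"
  using M_eq J2_app by (fastforce simp: J2_def)

lemma norm2_app: "norm2 \<rho> (app a) = nrm a"
  by (simp only: norm2_def nrm_def sq_def tr_def op_abs_square)

lemma sq_nonneg [simp]: "0 \<le> sq a" by (simp add: sq_def)
lemma nrm_nonneg [simp]: "0 \<le> nrm a" by (simp add: nrm_def)
lemma nrm_power2: "(nrm a)\<^sup>2 = sq a" by (simp add: nrm_def)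

lemma ennreal_sq: "J a \<Longrightarrow> tr (star a * a) = ennreal (sq a)"
  by (simp add: sq_def J_def)

text \<open>The trace is additive on positive operators only. Each relation between values of the trace
  therefore comes from an identity between two sums of positive operators.\<close>

lemma tr_parallelogram:
  assumes [simp]: "mem x" "mem y"
  shows "tr (star (x + y) * (x + y)) + tr (star (x - y) * (x - y))
    = (tr (star x * x) + tr (star x * x)) + (tr (star y * y) + tr (star y * y))"
proof -
  have "star (x + y) * (x + y) + star (x - y) * (x - y)
      = (star x * x + star x * x) + (star y * y + star y * y)"
    by (simp add: algebra_simps)
  from arg_cong[OF this, of tr] show ?thesis
    by (simp add: tr_add pos_add del: star_simps)
qed

lemma J_add_diff:
  assumes "J x" "J y"
  shows J_add [simp]: "J (x + y)" and J_diff [simp]: "J (x - y)"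
proof -
  have "tr (star (x + y) * (x + y)) + tr (star (x - y) * (x - y)) < \<infinity>"
    using assms unfolding tr_parallelogram[OF J_mem J_mem, OF assms] by (simp add: J_def del: J_mem)
  then show "J (x + y)" "J (x - y)" using assms by (auto simp: J_def simp del: J_mem)
qed

lemma sq_parallelogram:
  assumes "J x" "J y"
  shows "sq (x + y) + sq (x - y) = 2 * sq x + 2 * sq y"
  using tr_parallelogram[OF J_mem J_mem, OF assms] assms
  by (simp add: ennreal_sq J_add_diff ennreal_plus[symmetric] del: ennreal_plus star_simps)

lemma tr_scal_mult:
  assumes "mem x"
  shows "tr (star (scal c * x) * (scal c * x)) = ennreal ((cmod c)\<^sup>2) * tr (star x * x)"
proof -
  have "star (scal c * x) * (scal c * x) = star x * (scal (cnj c * c) * x)"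
    by (simp add: mult.assoc scal_mult)
  also have "cnj c * c = complex_of_real ((cmod c)\<^sup>2)"
    by (metis complex_norm_square mult.commute of_real_power)
  finally have "star (scal c * x) * (scal c * x) = (cmod c)\<^sup>2 *\<^sub>R (star x * x)"
    by (simp add: scal_of_real del: star_simps of_real_power)
  then show ?thesis using tr_scaleR[of "star x * x"] assms by simp
qed

lemma J_scal [simp]: "J x \<Longrightarrow> J (scal c * x)"
  using tr_scal_mult[of x c] by (simp add: J_def ennreal_mult_less_top del: J_mem)

lemma sq_scal: "J x \<Longrightarrow> sq (scal c * x) = (cmod c)\<^sup>2 * sq x"
  unfolding sq_def using tr_scal_mult[of x c] by (simp add: enn2real_mult)

lemma nrm_scal: "J x \<Longrightarrow> nrm (scal c * x) = cmod c * nrm x"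
  by (simp add: nrm_def sq_scal real_sqrt_mult)

lemma scaleR_eq_scal: "r *\<^sub>R (x::'k bop) = scal (complex_of_real r) * x"
  by (simp add: scal_of_real)

lemma J_scaleR [simp]: "J x \<Longrightarrow> J (r *\<^sub>R x)"
  by (simp only: scaleR_eq_scal J_scal)

lemma nrm_scaleR: "J x \<Longrightarrow> nrm (r *\<^sub>R x) = \<bar>r\<bar> * nrm x"
  by (simp only: scaleR_eq_scal nrm_scal norm_of_real)

lemma J_zero [simp]: "J 0" 
  using tr_scaleR[of 0 0] by (simp add: J_def del: J_mem)

lemma nrm_zero [simp]: "nrm 0 = 0"
  using nrm_scaleR[of 0 0] by simp

lemma nrm_minus: "J x \<Longrightarrow> J y \<Longrightarrow> nrm (x - y) = nrm (y - x)"
  using nrm_scaleR[of "y - x" "- 1"] by simp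

lemma J_star [simp]: "J x \<Longrightarrow> J (star x)"
  using tr_star_commute[of x] by (simp add: J_def del: J_mem)

text \<open>The mixed terms of the two squares on the left cancel. This replaces the inner product in the
  proof of the triangle inequality.\<close>

lemma tr_add_scaled:
  assumes [simp]: "mem x" "mem y" and t: "t > 0"
  shows "tr (star (x - t *\<^sub>R y) * (x - t *\<^sub>R y)) + ennreal t * tr (star (x + y) * (x + y))
    = ennreal (1 + t) * tr (star x * x) + ennreal (t * t + t) * tr (star y * y)"
proof -
  have "star (x - t *\<^sub>R y) * (x - t *\<^sub>R y) + t *\<^sub>R (star (x + y) * (x + y))
      = (1 + t) *\<^sub>R (star x * x) + (t * t + t) *\<^sub>R (star y * y)"
    by (simp add: algebra_simps)
  from arg_cong[OF this, of tr] show ?thesis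
    using t by (simp add: tr_add tr_scaleR pos_add pos_scaleR del: star_simps)
qed

text \<open>Dropping the nonnegative square of \<open>x - t y\<close> bounds the mixed term of \<open>x + y\<close> by
  \<open>\<parallel>x\<parallel>\<^sup>2 / t + t \<parallel>y\<parallel>\<^sup>2\<close> for all \<open>t > 0\<close>, hence by \<open>2 \<parallel>x\<parallel> \<parallel>y\<parallel>\<close>.\<close>

lemma nrm_triangle:
  assumes J: "J x" "J y"
  shows "nrm (x + y) \<le> nrm x + nrm y"
proof -
  have "sq (x + y) - sq x - sq y \<le> sq x / t + t * sq y" if t: "0 < t" for t
  proof -
    have "sq (x - t *\<^sub>R y) + t * sq (x + y) = (1 + t) * sq x + (t * t + t) * sq y"
      using tr_add_scaled[OF J_mem J_mem t, OF J] J t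
      by (simp add: ennreal_sq J_add_diff ennreal_plus[symmetric] ennreal_mult[symmetric]
          del: ennreal_plus star_simps)
    then have "t * sq (x + y) \<le> (1 + t) * sq x + (t * t + t) * sq y"
      using sq_nonneg[of "x - t *\<^sub>R y"] by linarith
    then have "t * (sq (x + y) - sq x - sq y) \<le> t * (sq x / t + t * sq y)"
      using t by (simp add: algebra_simps)
    then show ?thesis using t by (simp only: mult_le_cancel_left_pos)
  qed
  from mean_inequality_limit[OF sq_nonneg sq_nonneg this]
  have "(nrm (x + y))\<^sup>2 \<le> (nrm x + nrm y)\<^sup>2"
    unfolding nrm_power2 power2_sum by (simp add: nrm_def)
  then show ?thesis by (rule power2_le_imp_le) simp
qed

lemma nrm_triangle_diff: "J x \<Longrightarrow> J y \<Longrightarrow> nrm (x - y) \<le> nrm x + nrm y"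
  using nrm_triangle[of x "(- 1) *\<^sub>R y"] nrm_scaleR[of y "- 1"] J_scaleR[of y "- 1"]
  by simp

lemma J_mult_left:
  assumes a: "mem a" and x: "J x"
  shows "J (a * x)"
proof -
  obtain C where C: "C > 0" "\<And>v. norm (app a v) \<le> C * norm v" by (rule app_bounded[of a]) blast
  have "pos ((C * C) *\<^sub>R (star x * x) - star (a * x) * (a * x))"
    unfolding pos_def
  proof safe
    fix v
    have "(norm (app a (app x v)))\<^sup>2 \<le> (C * norm (app x v))\<^sup>2"
      by (rule power_mono[OF C(2)]) simp
    then show "0 \<le> inner (app ((C * C) *\<^sub>R (star x * x) - star (a * x) * (a * x)) v) v"
      by (simp add: inner_diff_left star_left power2_norm_eq_inner[symmetric] power_mult_distrib
          power2_eq_square[of C])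
  qed (simp add: mult.assoc)
  then have "tr (star (a * x) * (a * x)) \<le> tr ((C * C) *\<^sub>R (star x * x))"
    using a x by (intro tr_mono) (auto simp del: star_simps)
  also have "\<dots> < \<infinity>"
    using x tr_scaleR[of "star x * x" "C * C"] C(1) by (simp add: J_def ennreal_mult_less_top del: J_mem)
  finally show ?thesis using a x by (simp add: J_def del: J_mem)
qed

lemma J_mult_right:
  assumes "mem a" "J x"
  shows "J (x * a)"
  using J_star[OF J_mult_left[of "star a" "star x"]] assms by simp

subsection \<open>Positive elements span acute angles\<close>

text \<open>Formally \<open>\<rho> (x y) = \<rho> (w x w) \<ge> 0\<close> for \<open>y = w\<^sup>2\<close>. Since \<open>w\<close> is square integrable, so is
  \<open>z = w x\<close>, and comparing \<open>(z + w)\<^sup>* (z + w)\<close> with \<open>(z + w) (z + w)\<^sup>*\<close>, which have the same trace,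
  makes the cyclic permutation rigorous.\<close>

lemma nrm_diff_le_add_square:
  assumes x: "J x" "pos x" and w: "J w" "pos w" and y: "J (w * w)"
  shows "nrm (x - w * w) \<le> nrm (x + w * w)"
proof -
  let ?y = "w * w" and ?z = "w * x"
  have st: "star x = x" "star w = w" using posD(1) x w by auto
  have z: "J ?z" using x w by (intro J_mult_left) auto
  have wxw: "pos (w * x * w)" using pos_conj[OF x(2), of w] by (simp add: st)
  have "sq (x + ?y) + (sq ?z + sq w) \<ge> sq x + sq ?y + sq (?z + w)"
  proof -
    have "star (x + ?y) * (x + ?y) + (star ?z * ?z + star w * w)
        = star x * x + star ?y * ?y + star (?z + w) * (?z + w)"
      by (simp add: algebra_simps st)
    from arg_cong[OF this, of tr]
    have "tr (star (x + ?y) * (x + ?y)) + (tr (star ?z * ?z) + tr (star w * w))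
        = tr (star x * x) + tr (star ?y * ?y) + tr (star (?z + w) * (?z + w))"
      using x w by (simp add: tr_add pos_add del: star_simps)
    then show ?thesis
      using x w y z
      by (simp add: ennreal_sq J_add_diff ennreal_plus[symmetric] del: ennreal_plus star_simps)
  qed
  moreover have "sq ?z + sq w \<le> sq (?z + w)"
  proof -
    have "tr (star (?z + w) * (?z + w)) = tr ((?z + w) * star (?z + w))"
      using x w by (intro tr_star_commute) auto
    also have "(?z + w) * star (?z + w) = (?z * star ?z + w * star w) + (w * x * w + w * x * w)"
      by (simp add: algebra_simps st)
    also have "tr \<dots> = (tr (?z * star ?z) + tr (w * star w)) + (tr (w * x * w) + tr (w * x * w))"
      using x w wxw by (simp add: tr_add pos_add del: star_simps)
    also have "\<dots> \<ge> tr (?z * star ?z) + tr (w * star w)" by simp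
    also have "tr (?z * star ?z) + tr (w * star w) = tr (star ?z * ?z) + tr (star w * w)"
      using x w by (simp add: tr_star_commute del: star_simps)
    finally show ?thesis
      using x w z
      by (simp add: ennreal_sq J_add_diff ennreal_plus[symmetric] del: ennreal_plus star_simps)
  qed
  moreover have "sq (x + ?y) + sq (x - ?y) = 2 * sq x + 2 * sq ?y"
    using sq_parallelogram x y by blast
  ultimately have "sq (x - ?y) \<le> sq (x + ?y)" by linarith
  then show ?thesis by (simp add: nrm_def)
qed

end

subsection \<open>Truncation of a positive contraction\<close>

lemma pos_power: "pos a \<Longrightarrow> pos (a ^ n)"
  by (induction n) (auto intro: pos_mult simp: power_commutes)

text \<open>For \<open>0 \<le> y \<le> 1\<close> the polynomials \<open>y - y (1 - y)\<^sup>n\<close> increase to \<open>y\<close>. They are dominated by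
  multiples of \<open>y\<^sup>2\<close>, so they have finite trace if \<open>y\<^sup>2\<close> has. This replaces cutting off the spectrum
  of \<open>y\<close> near zero.\<close>

locale positive_contraction =
  fixes y :: "'k::complex_hilbert bop"
  assumes pos_y: "pos y" and pos_1_y: "pos (1 - y)"
begin

abbreviation u where "u \<equiv> 1 - y"

lemma y_commute: "y * u ^ n = u ^ n * y"
  by (rule power_commuting_commutes[symmetric]) (simp add: algebra_simps)

lemma y_commute': "y * (u ^ n * z) = u ^ n * (y * z)"
  by (metis mult.assoc y_commute)

lemma power_step: "u ^ Suc n = u ^ n - u ^ n * y"
  by (simp add: power_Suc2 algebra_simps del: power_Suc)

lemma pos_u: "pos (u ^ n)"
  by (rule pos_power[OF pos_1_y])

lemma pos_yu: "pos (y * u ^ n)"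
  by (rule pos_mult[OF pos_y pos_u y_commute])

lemma pos_yuy: "pos (y * u ^ n * y)"
  using pos_conj[OF pos_u[of n], of y] by (simp only: posD(1)[OF pos_y])

lemma pos_1_u: "pos (1 - u ^ n)"
proof (induction n)
  case (Suc n)
  have "1 - u ^ Suc n = (1 - u ^ n) + y * u ^ n"
    unfolding power_step y_commute by simp
  with Suc pos_yu show ?case by (simp only: pos_add)
qed simp

lemma pos_truncation: "pos (y - y * u ^ n)"
proof -
  have "y * (1 - u ^ n) = (1 - u ^ n) * y"
    by (simp only: left_diff_distrib right_diff_distrib y_commute mult_1_left mult_1_right)
  from pos_mult[OF pos_y pos_1_u this] show ?thesis by (simp only: right_diff_distrib mult_1_right)
qed

text \<open>The operator inequality \<open>n y (1 - y)\<^sup>n \<le> 1 - (1 - y)\<^sup>n\<close>, by induction on \<open>n\<close>: passing to \<open>n + 1\<close> adds the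
  positive operator \<open>(n + 1) y (1 - y)\<^sup>n y\<close> to the difference of the two sides.\<close>

lemma pos_remainder_bound: "pos (1 - real n *\<^sub>R (y * u ^ n))"
proof -
  have "pos ((1 - u ^ n) - real n *\<^sub>R (y * u ^ n))"
  proof (induction n)
    case (Suc n)
    have "(1 - u ^ Suc n) - real (Suc n) *\<^sub>R (y * u ^ Suc n)
        = ((1 - u ^ n) - real n *\<^sub>R (y * u ^ n)) + real (Suc n) *\<^sub>R (y * u ^ n * y)"
      unfolding power_step by (simp add: y_commute y_commute' algebra_simps)
    with Suc pos_yuy show ?case by (simp only: pos_add pos_scaleR of_nat_0_le_iff)
  qed simp
  from pos_add[OF this pos_u[of n]] show ?thesis by simp
qed

lemma pos_yuy_bound: "pos (1 - real n *\<^sub>R (y * u ^ n * y))"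
proof -
  have "pos (y * u ^ n - y * u ^ n * y)"
    using pos_yu[of "Suc n"] unfolding power_step by (simp add: right_diff_distrib mult.assoc)
  from pos_add[OF pos_remainder_bound[of n] pos_scaleR[OF this, of "real n"]]
  show ?thesis by (simp add: scaleR_diff_right)
qed

lemma yuy_tendsto: "(\<lambda>n. inner (app (y * u ^ n * y) x) x) \<longlonglongrightarrow> 0"
proof -
  have "inner (app (y * u ^ Suc n * y) x) x \<le> inner x x * (1 / real (Suc n))" for n
  proof -
    have "real (Suc n) * inner (app (y * u ^ Suc n * y) x) x \<le> inner x x"
      using posD(2)[OF pos_yuy_bound[of "Suc n"], of x]
      by (simp add: inner_diff_left del: times_bop.rep_eq power_Suc of_nat_Suc)
    then show ?thesis by (simp add: pos_le_divide_eq mult.commute del: times_bop.rep_eq power_Suc of_nat_Suc)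
  qed
  then have up: "\<forall>\<^sub>F n in sequentially. inner (app (y * u ^ Suc n * y) x) x \<le> inner x x * (1 / real (Suc n))"
    by (intro always_eventually allI)
  have low: "\<forall>\<^sub>F n in sequentially. 0 \<le> inner (app (y * u ^ Suc n * y) x) x"
    by (intro always_eventually allI posD(2)[OF pos_yuy])
  have lim: "(\<lambda>n. inner x x * (1 / real (Suc n))) \<longlonglongrightarrow> 0"
    using tendsto_mult_left[OF LIMSEQ_Suc[OF lim_1_over_n], of "inner x x"] by simp
  have "(\<lambda>n. inner (app (y * u ^ Suc n * y) x) x) \<longlonglongrightarrow> 0"
    by (rule tendsto_sandwich[OF low up tendsto_const lim])
  then show ?thesis by (rule LIMSEQ_imp_Suc)
qed

end

context traced_algebra
begin

context
  fixes y :: "'k bop"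
  assumes pos_y: "pos y" and pos_1_y: "pos (1 - y)" and J_y: "J y"
begin

interpretation positive_contraction y
  by unfold_locales (rule pos_y pos_1_y)+

lemma mem_u [simp]: "mem y" "mem (u ^ n)"
  using J_y by simp_all

lemma tr_yuy_split: "tr (y * y) = tr (y * y - y * u ^ n * y) + tr (y * u ^ n * y)"
proof -
  have "pos (y * y - y * u ^ n * y)"
    using pos_conj[OF pos_1_u[of n], of y] by (simp add: posD(1)[OF pos_y] algebra_simps)
  then show ?thesis
    using tr_add[of "y * y - y * u ^ n * y" "y * u ^ n * y"] pos_yuy by simp
qed

lemma tr_yy_finite: "tr (y * y) < \<infinity>"
  using J_y posD(1)[OF pos_y] by (simp add: J_def del: J_mem)

lemma tr_yuy_finite: "tr (y * u ^ n * y) < \<infinity>"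
  using tr_yuy_split[of n] tr_yy_finite by auto

text \<open>Normality of the trace enters here: \<open>y\<^sup>2\<close> is the supremum of the increasing sequence
  \<open>y\<^sup>2 - y (1 - y)\<^sup>n y\<close>, so the traces of the remainders decrease to zero.\<close>

lemma tr_yuy_small:
  assumes "e > 0"
  obtains n where "tr (y * u ^ n * y) < e"
proof -
  define s where "s n = y * y - y * u ^ n * y" for n
  have mem_s [simp]: "mem (s n)" for n by (simp add: s_def)
  have s_pos: "pos (s n)" for n
    using pos_conj[OF pos_1_u[of n], of y] by (simp add: s_def posD(1)[OF pos_y] algebra_simps)
  have s_step: "s (Suc n) = s n + (y * u ^ n * y) * y" for n
    unfolding s_def power_step by (simp add: algebra_simps)
  have comm: "(y * u ^ n * y) * y = y * (y * u ^ n * y)" for n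
    by (simp add: mult.assoc y_commute y_commute')
  have s_mono: "pos (s m - s n)" if "n \<le> m" for m n
    using that
  proof (induction m rule: dec_induct)
    case (step m)
    have "s (Suc m) - s n = (s m - s n) + (y * u ^ m * y) * y" by (simp add: s_step)
    with pos_add[OF step.IH pos_mult[OF pos_yuy pos_y comm]] show ?case by (simp only:)
  qed simp
  have "\<rho> (app (y * y)) = (SUP x\<in>(\<lambda>n. app (s n)) ` UNIV. \<rho> x)"
  proof (rule normal[unfolded normal_trace_def, rule_format], intro conjI)
    show "(\<lambda>n. app (s n)) ` UNIV \<subseteq> positive_part M"
      using s_pos by (auto simp: positive_part_app)
    show "(\<lambda>n. app (s n)) ` UNIV \<noteq> {}" by simp
    show "\<forall>a\<in>(\<lambda>n. app (s n)) ` UNIV. \<forall>b\<in>(\<lambda>n. app (s n)) ` UNIV.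
        \<exists>c\<in>(\<lambda>n. app (s n)) ` UNIV. op_le a c \<and> op_le b c"
    proof safe
      fix m n
      show "\<exists>c\<in>(\<lambda>n. app (s n)) ` UNIV. op_le (app (s m)) c \<and> op_le (app (s n)) c"
        using s_mono[of m "max m n"] s_mono[of n "max m n"]
        by (intro bexI[of _ "app (s (max m n))"]) (auto simp: op_le_app)
    qed
    show "app (y * y) \<in> positive_part M"
      using pos_yuy[of 0] by (simp add: positive_part_app del: times_bop.rep_eq)
    show "\<forall>a\<in>(\<lambda>n. app (s n)) ` UNIV. op_le a (app (y * y))"
      using pos_yuy by (auto simp: op_le_app s_def simp del: times_bop.rep_eq)
    show "\<forall>t\<in>positive_part M. (\<forall>a\<in>(\<lambda>n. app (s n)) ` UNIV. op_le a t) \<longrightarrow> op_le (app (y * y)) t"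
    proof (intro ballI impI)
      fix t assume t: "t \<in> positive_part M" and ub: "\<forall>a\<in>(\<lambda>n. app (s n)) ` UNIV. op_le a t"
      from t have "t \<in> bounded_ops" by (simp add: positive_part_def positive_op_def)
      then obtain t' where t': "t = app t'" by (metis Bop_inverse)
      with t have "pos t'" by (simp add: positive_part_app del: times_bop.rep_eq)
      have "pos (t' - y * y)"
        unfolding pos_def
      proof safe
        show "star (t' - y * y) = t' - y * y"
          using posD(1)[OF \<open>pos t'\<close>] posD(1)[OF pos_y] by simp
        fix x
        have "pos (t' - y * y + y * u ^ n * y)" for n
          using ub by (simp add: t' op_le_app s_def algebra_simps)
        from posD(2)[OF this]
        have "0 \<le> inner (app (t' - y * y) x) x + inner (app (y * u ^ n * y) x) x" for n
          by (simp add: inner_add_left[symmetric] del: app_minus times_bop.rep_eq)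
        moreover have "(\<lambda>n. inner (app (t' - y * y) x) x + inner (app (y * u ^ n * y) x) x)
            \<longlonglongrightarrow> inner (app (t' - y * y) x) x + 0"
          by (intro tendsto_add tendsto_const yuy_tendsto)
        ultimately show "0 \<le> inner (app (t' - y * y) x) x"
          using LIMSEQ_le_const by fastforce
      qed
      then show "op_le (app (y * y)) t" unfolding t' op_le_app .
    qed
  qed
  then have sup: "tr (y * y) = (SUP n. tr (s n))"
    by (simp add: tr_def image_image del: times_bop.rep_eq)
  show ?thesis
  proof (cases "tr (y * y) = 0")
    \<comment> \<open>In \<^typ>\<open>ennreal\<close> the strict inequality \<open>a - e < a\<close> needs \<open>a \<noteq> 0\<close>.\<close>
    case True
    then have "tr (y * u ^ 0 * y) < e" using assms by simp
    then show ?thesis by (rule that)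
  next
    case False
    have "tr (y * y) - e < tr (y * y)"
      using False assms tr_yy_finite by (intro ennreal_between) (auto simp: zero_less_iff_neq_zero)
    then obtain n where n: "tr (y * y) - e < tr (s n)"
      unfolding sup less_SUP_iff by blast
    have "tr (y * u ^ n * y) < e"
    proof (rule ccontr)
      assume "\<not> tr (y * u ^ n * y) < e"
      then have "tr (s n) + e \<le> tr (y * y)"
        using tr_yuy_split[of n] by (simp add: s_def add_left_mono)
      moreover from this have "e \<noteq> top" using tr_yy_finite by (auto simp: top_unique)
      ultimately have "tr (s n) \<le> tr (y * y) - e"
        using ennreal_minus_mono[of "tr (s n) + e" "tr (y * y)" e e] by simp
      with n show False by simp
    qed
    then show ?thesis by (rule that)
  qed
qed

lemma tr_truncation_finite: "tr (y - y * u ^ n) < \<infinity>"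
proof (induction n)
  case 0
  show ?case using tr_scaleR[of 0 0] by simp
next
  case (Suc n)
  have "y - y * u ^ Suc n = (y - y * u ^ n) + y * u ^ n * y"
    unfolding power_step by (simp add: algebra_simps)
  moreover have "tr ((y - y * u ^ n) + y * u ^ n * y) = tr (y - y * u ^ n) + tr (y * u ^ n * y)"
    using pos_truncation pos_yuy by (intro tr_add) simp_all
  ultimately have "tr (y - y * u ^ Suc n) = tr (y - y * u ^ n) + tr (y * u ^ n * y)"
    by (simp only:)
  then show ?case using Suc tr_yuy_finite by simp
qed

text \<open>The approximant is the square of \<open>w = (y - y (1 - y)\<^sup>n)\<^sup>1\<^sup>/\<^sup>2\<close>. The error \<open>y (1 - y)\<^sup>n\<close> has the square
  \<open>y (1 - y)\<^sup>2\<^sup>n y \<le> y (1 - y)\<^sup>n y\<close>, whose trace is small.\<close>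

lemma truncation_approximates:
  assumes "e > 0"
  obtains w where "pos w" "J w" "J (w * w)" "nrm (y - w * w) < e"
proof -
  obtain n where n: "tr (y * u ^ n * y) < ennreal (e\<^sup>2)"
    using tr_yuy_small[of "ennreal (e\<^sup>2)"] assms by auto
  define v where "v = y - y * u ^ n"
  have "pos v" unfolding v_def by (rule pos_truncation)
  moreover have "mem v" by (simp add: v_def)
  ultimately obtain w where w: "pos w" "w * w = v" "mem w" using mem_sqrt by blast
  have J_yu: "J (y * u ^ n)" by (rule J_mult_right[OF _ J_y]) simp
  have pos1: "star (y * u ^ n) = y * u ^ n" by (rule posD(1)[OF pos_yu])
  show ?thesis
  proof (rule that)
    show "pos w" by fact
    show "J w" using w tr_truncation_finite[of n] by (simp add: J_def posD(1) v_def del: J_mem)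
    show "J (w * w)" using J_y J_yu by (simp add: w(2) v_def)
    have "sq (y * u ^ n) < e\<^sup>2"
    proof -
      have u1: "u ^ n * (1 - u ^ n) = (1 - u ^ n) * u ^ n" by (simp add: algebra_simps)
      have "y * u ^ n * y - (y * u ^ n) * (y * u ^ n) = star y * (u ^ n * (1 - u ^ n)) * y"
        by (simp add: posD(1)[OF pos_y] algebra_simps y_commute y_commute')
      then have "pos (y * u ^ n * y - (y * u ^ n) * (y * u ^ n))"
        using pos_conj[OF pos_mult[OF pos_u pos_1_u u1], of y] by (simp only:)
      moreover have "pos ((y * u ^ n) * (y * u ^ n))"
        using pos_star_mult(1)[of "y * u ^ n"] by (simp only: pos1)
      ultimately have "tr (star (y * u ^ n) * (y * u ^ n)) \<le> tr (y * u ^ n * y)"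
        unfolding pos1 by (intro tr_mono) simp_all
      also note n
      finally show ?thesis
        unfolding ennreal_sq[OF J_yu] by (simp add: ennreal_less_iff)
    qed
    then have "nrm (y * u ^ n) < e"
      unfolding nrm_power2[symmetric] using assms by (simp add: power2_less_imp_less)
    then show "nrm (y - w * w) < e" by (simp add: w(2) v_def)
  qed
qed

end

text \<open>Elements of the positive cone have nonnegative inner products. The root of \<open>y\<close> need not be
  square integrable, so \<open>y\<close> is first approximated by squares of square-integrable operators.\<close>

lemma nrm_diff_le_add:
  assumes x: "J x" "pos x" and y: "J y" "pos y"
  shows "nrm (x - y) \<le> nrm (x + y)"
proof -
  obtain C where C: "C > 0" "\<And>v. norm (app y v) \<le> C * norm v" by (rule app_bounded[of y]) blast
  define x' where "x' = (1 / C) *\<^sub>R x"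
  define y' where "y' = (1 / C) *\<^sub>R y"
  have J': "J x'" "J y'" using x y by (simp_all add: x'_def y'_def)
  have pos': "pos x'" "pos y'" using x y C(1) by (simp_all add: x'_def y'_def pos_scaleR)
  have "pos (1 - y')"
    unfolding pos_def
  proof safe
    show "star (1 - y') = 1 - y'" using posD(1)[OF pos'(2)] by simp
    fix v
    have "inner (app y v) v \<le> C * norm v * norm v"
      using norm_cauchy_schwarz[of "app y v" v] mult_right_mono[OF C(2)[of v], of "norm v"] by simp
    then have "inner (app y v) v / C \<le> inner v v"
      using C(1) by (simp add: pos_divide_le_eq power2_norm_eq_inner[symmetric] power2_eq_square mult_ac)
    then show "0 \<le> inner (app (1 - y') v) v" by (simp add: y'_def inner_diff_left)
  qed
  note approx = truncation_approximates[OF pos'(2) this J'(2)]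
  have "nrm (x' - y') \<le> nrm (x' + y') + e" if "e > 0" for e
  proof -
    from that have "e / 2 > 0" by simp
    then obtain w where w: "pos w" "J w" "J (w * w)" "nrm (y' - w * w) < e / 2" by (rule approx)
    have "nrm (x' - y') \<le> nrm (x' - w * w) + nrm (y' - w * w)"
      using nrm_triangle_diff[of "x' - w * w" "y' - w * w"] J' w by simp
    also have "nrm (x' - w * w) \<le> nrm (x' + w * w)"
      by (rule nrm_diff_le_add_square[OF J'(1) pos'(1) w(2,1,3)])
    also have "nrm (x' + w * w) \<le> nrm (x' + y') + nrm (y' - w * w)"
      using nrm_triangle_diff[of "x' + y'" "y' - w * w"] J' w by simp
    finally show ?thesis using w(4) by simp
  qed
  then have "nrm (x' - y') \<le> nrm (x' + y')" by (rule field_le_epsilon)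
  then have "1 / C * nrm (x - y) \<le> 1 / C * nrm (x + y)"
    using nrm_scaleR[of "x - y" "1 / C"] nrm_scaleR[of "x + y" "1 / C"] x y C(1)
    by (simp add: x'_def y'_def scaleR_diff_right scaleR_add_right)
  then show ?thesis using C(1) by (simp add: divide_le_cancel)
qed

end

section \<open>The completion\<close>

context traced_algebra
begin

definition cauchy :: "(nat \<Rightarrow> 'k bop) \<Rightarrow> bool" where
  "cauchy x \<longleftrightarrow> (\<forall>n. J (x n)) \<and> (\<forall>e>0. \<exists>N. \<forall>m\<ge>N. \<forall>n\<ge>N. nrm (x m - x n) < e)"

definition null :: "(nat \<Rightarrow> 'k bop) \<Rightarrow> bool" where
  "null x \<longleftrightarrow> (\<forall>n. J (x n)) \<and> (\<lambda>n. nrm (x n)) \<longlonglongrightarrow> 0"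

text \<open>The equivalence class of the sequence of functions underlying \<open>x\<close>, described by operator-valued
  sequences.\<close>

definition cls :: "(nat \<Rightarrow> 'k bop) \<Rightarrow> (nat \<Rightarrow> 'k \<Rightarrow> 'k) set" where
  "cls x = {\<lambda>n. app (z n) | z. cauchy z \<and> null (\<lambda>n. x n - z n)}"

lemma clsI: "cauchy z \<Longrightarrow> null (\<lambda>n. x n - z n) \<Longrightarrow> (\<lambda>n. app (z n)) \<in> cls x"
  unfolding cls_def by (rule CollectI, rule exI[of _ z]) simp

lemma clsE:
  assumes "s \<in> cls x"
  obtains z where "s = (\<lambda>n. app (z n))" "cauchy z" "null (\<lambda>n. x n - z n)"
  using assms unfolding cls_def by (elim CollectE exE conjE) (rule that)

definition lnorm :: "(nat \<Rightarrow> 'k bop) \<Rightarrow> real" where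
  "lnorm x = lim (\<lambda>n. nrm (x n))"

lemma cauchyJ [simp]: "cauchy x \<Longrightarrow> J (x n)" by (simp add: cauchy_def)

lemma null_zero [simp]: "null (\<lambda>n. 0)" by (simp add: null_def)

lemma null_add:
  assumes "null x" "null y"
  shows "null (\<lambda>n. x n + y n)"
proof -
  have "(\<lambda>n. nrm (x n + y n)) \<longlonglongrightarrow> 0"
  proof (rule Lim_null_comparison)
    show "\<forall>\<^sub>F n in sequentially. norm (nrm (x n + y n)) \<le> nrm (x n) + nrm (y n)"
      using assms by (intro always_eventually allI) (auto simp: null_def intro: nrm_triangle)
    show "(\<lambda>n. nrm (x n) + nrm (y n)) \<longlonglongrightarrow> 0"
      using assms tendsto_add[of "\<lambda>n. nrm (x n)" 0 sequentially "\<lambda>n. nrm (y n)" 0]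
      by (simp add: null_def)
  qed
  then show ?thesis using assms by (simp add: null_def)
qed

lemma null_scal:
  assumes "null x"
  shows "null (\<lambda>n. scal c * x n)"
proof -
  have "(\<lambda>n. cmod c * nrm (x n)) \<longlonglongrightarrow> cmod c * 0"
    using assms by (intro tendsto_intros) (simp add: null_def)
  then show ?thesis using assms by (simp add: null_def nrm_scal)
qed

lemma null_scaleR: "null x \<Longrightarrow> null (\<lambda>n. r *\<^sub>R x n)"
  unfolding scaleR_eq_scal by (rule null_scal)

lemma null_diff: "null x \<Longrightarrow> null y \<Longrightarrow> null (\<lambda>n. x n - y n)"
  using null_add[of x "\<lambda>n. (- 1) *\<^sub>R y n"] null_scaleR[of y "- 1"] by simp

lemma null_swap: "null (\<lambda>n. x n - y n) \<Longrightarrow> null (\<lambda>n. y n - x n)"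
  using null_scaleR[of "\<lambda>n. x n - y n" "- 1"] by simp

lemma null_trans: "null (\<lambda>n. x n - y n) \<Longrightarrow> null (\<lambda>n. y n - z n) \<Longrightarrow> null (\<lambda>n. x n - z n)"
  using null_add[of "\<lambda>n. x n - y n" "\<lambda>n. y n - z n"] by simp

lemma cauchy_add:
  assumes "cauchy x" "cauchy y"
  shows "cauchy (\<lambda>n. x n + y n)"
  unfolding cauchy_def
proof (intro conjI allI impI)
  show "J (x n + y n)" for n using assms by simp
  fix e :: real assume "e > 0"
  then have "e / 2 > 0" by simp
  then obtain N1 N2 where N: "\<And>m n. m \<ge> N1 \<Longrightarrow> n \<ge> N1 \<Longrightarrow> nrm (x m - x n) < e / 2"
      "\<And>m n. m \<ge> N2 \<Longrightarrow> n \<ge> N2 \<Longrightarrow> nrm (y m - y n) < e / 2"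
    using assms unfolding cauchy_def by meson
  have "nrm (x m + y m - (x n + y n)) < e" if "m \<ge> max N1 N2" "n \<ge> max N1 N2" for m n
    using nrm_triangle[of "x m - x n" "y m - y n"] N(1)[of m n] N(2)[of m n] assms that
    by (simp add: algebra_simps)
  then show "\<exists>N. \<forall>m\<ge>N. \<forall>n\<ge>N. nrm (x m + y m - (x n + y n)) < e" by blast
qed

lemma cauchy_scal:
  assumes "cauchy x"
  shows "cauchy (\<lambda>n. scal c * x n)"
  unfolding cauchy_def
proof (intro conjI allI impI)
  show "J (scal c * x n)" for n using assms by simp
  fix e :: real assume "e > 0"
  then have "e / (cmod c + 1) > 0" by (simp add: add_nonneg_pos)
  then obtain N where N: "\<And>m n. m \<ge> N \<Longrightarrow> n \<ge> N \<Longrightarrow> nrm (x m - x n) < e / (cmod c + 1)"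
    using assms unfolding cauchy_def by meson
  have "nrm (scal c * x m - scal c * x n) < e" if "m \<ge> N" "n \<ge> N" for m n
  proof -
    have "(cmod c + 1) * nrm (x m - x n) < e"
      using N[OF that] by (simp add: pos_less_divide_eq add_nonneg_pos mult.commute)
    moreover have "nrm (scal c * x m - scal c * x n) = cmod c * nrm (x m - x n)"
      using nrm_scal[of "x m - x n" c] assms by (simp add: right_diff_distrib)
    ultimately show ?thesis
      using nrm_nonneg[of "x m - x n"] unfolding distrib_right mult_1_left by linarith
  qed
  then show "\<exists>N. \<forall>m\<ge>N. \<forall>n\<ge>N. nrm (scal c * x m - scal c * x n) < e" by blast
qed

lemma cauchy_scaleR: "cauchy x \<Longrightarrow> cauchy (\<lambda>n. r *\<^sub>R x n)"
  unfolding scaleR_eq_scal by (rule cauchy_scal)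

lemma nrm_diff_abs: "J x \<Longrightarrow> J y \<Longrightarrow> \<bar>nrm x - nrm y\<bar> \<le> nrm (x - y)"
  using nrm_triangle[of "x - y" y] nrm_triangle[of "y - x" x] nrm_minus[of x y] by simp

lemma lnorm_tendsto:
  assumes "cauchy x"
  shows "(\<lambda>n. nrm (x n)) \<longlonglongrightarrow> lnorm x"
proof -
  have "Cauchy (\<lambda>n. nrm (x n))"
  proof (rule metric_CauchyI)
    fix e :: real assume "e > 0"
    then obtain N where N: "\<And>m n. m \<ge> N \<Longrightarrow> n \<ge> N \<Longrightarrow> nrm (x m - x n) < e"
      using assms unfolding cauchy_def by meson
    then have "dist (nrm (x m)) (nrm (x n)) < e" if "m \<ge> N" "n \<ge> N" for m n
      using order.strict_trans1[OF nrm_diff_abs N[OF that]] assms by (simp add: dist_real_def)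
    then show "\<exists>N. \<forall>m\<ge>N. \<forall>n\<ge>N. dist (nrm (x m)) (nrm (x n)) < e" by blast
  qed
  then show ?thesis
    unfolding lnorm_def by (simp add: Cauchy_convergent_iff convergent_LIMSEQ_iff)
qed

lemma nrm_tendsto_null:
  assumes "cauchy x" "cauchy y" "null (\<lambda>n. x n - y n)"
  shows "(\<lambda>n. nrm (y n)) \<longlonglongrightarrow> lnorm x"
proof -
  have "(\<lambda>n. nrm (y n) - nrm (x n)) \<longlonglongrightarrow> 0"
  proof (rule Lim_null_comparison)
    show "\<forall>\<^sub>F n in sequentially. norm (nrm (y n) - nrm (x n)) \<le> nrm (x n - y n)"
      using assms nrm_diff_abs[of "x n" "y n" for n]
      by (intro always_eventually allI) (simp add: abs_minus_commute)
    show "(\<lambda>n. nrm (x n - y n)) \<longlonglongrightarrow> 0" using assms(3) by (simp add: null_def)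
  qed
  from tendsto_add[OF this lnorm_tendsto[OF assms(1)]] show ?thesis by simp
qed

lemma lnorm_nonneg: "cauchy x \<Longrightarrow> 0 \<le> lnorm x"
  using LIMSEQ_le_const[OF lnorm_tendsto] by fastforce

lemma lnorm_scaleR: "cauchy x \<Longrightarrow> lnorm (\<lambda>n. r *\<^sub>R x n) = \<bar>r\<bar> * lnorm x"
  using lnorm_tendsto[OF cauchy_scaleR, of x r] tendsto_mult_left[OF lnorm_tendsto, of x "\<bar>r\<bar>"]
  by (simp add: nrm_scaleR LIMSEQ_unique)

lemma lnorm_add_le:
  assumes "cauchy x" "cauchy y"
  shows "lnorm (\<lambda>n. x n + y n) \<le> lnorm x + lnorm y"
  using LIMSEQ_le[OF lnorm_tendsto[OF cauchy_add[OF assms]]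
      tendsto_add[OF lnorm_tendsto[OF assms(1)] lnorm_tendsto[OF assms(2)]]]
    assms nrm_triangle by auto

subsection \<open>Classes of Cauchy sequences\<close>

lemma cauchy2_eq: "cauchy2 M \<rho> = {\<lambda>n. app (z n) | z. cauchy z}"
proof -
  have "x \<in> cauchy2 M \<rho> \<longleftrightarrow> (\<exists>z. x = (\<lambda>n. app (z n)) \<and> cauchy z)" for x
  proof
    assume x: "x \<in> cauchy2 M \<rho>"
    then have "\<forall>n. \<exists>a. x n = app a \<and> J a" unfolding cauchy2_def J2_eq by blast
    then obtain z where z: "\<And>n. x n = app (z n)" "\<And>n. J (z n)" by metis
    have "cauchy z"
      using x unfolding cauchy2_def cauchy_def by (simp add: z op_UNIV_app norm2_app del: app_minus)
    with z show "\<exists>z. x = (\<lambda>n. app (z n)) \<and> cauchy z" by blast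
  next
    assume "\<exists>z. x = (\<lambda>n. app (z n)) \<and> cauchy z"
    then show "x \<in> cauchy2 M \<rho>"
      unfolding cauchy2_def by (auto simp: cauchy_def J2_app op_UNIV_app norm2_app)
  qed
  then show ?thesis by blast
qed

lemma app_seq_inject: "(\<lambda>n. app (x n)) = (\<lambda>n. app (y n)) \<longleftrightarrow> x = y"
  by (metis app_inject ext)

lemma equiv2_iff:
  assumes "cauchy x" "cauchy y"
  shows "((\<lambda>n. app (x n)), (\<lambda>n. app (y n))) \<in> equiv2 M \<rho> \<longleftrightarrow> null (\<lambda>n. x n - y n)"
proof -
  have "(\<lambda>n. app (x n)) \<in> cauchy2 M \<rho>" "(\<lambda>n. app (y n)) \<in> cauchy2 M \<rho>"
    using assms unfolding cauchy2_eq by blast+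
  then show ?thesis
    using assms by (simp add: equiv2_def null_def op_UNIV_app norm2_app)
qed

lemma equiv2_Image:
  assumes "cauchy x"
  shows "equiv2 M \<rho> `` {\<lambda>n. app (x n)} = cls x"
proof -
  have "y \<in> cls x" if "((\<lambda>n. app (x n)), y) \<in> equiv2 M \<rho>" for y
  proof -
    from that have "y \<in> cauchy2 M \<rho>" by (simp add: equiv2_def)
    then obtain z where "y = (\<lambda>n. app (z n))" "cauchy z" unfolding cauchy2_eq by blast
    with that equiv2_iff[OF assms] show ?thesis unfolding cls_def by blast
  qed
  moreover have "((\<lambda>n. app (x n)), y) \<in> equiv2 M \<rho>" if "y \<in> cls x" for y
    using that equiv2_iff[OF assms] unfolding cls_def by blast
  ultimately show ?thesis by blast
qed

lemma cls_eqI: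
  assumes "null (\<lambda>n. x n - y n)"
  shows "cls x = cls y"
  unfolding cls_def using null_trans[of x y] null_trans[of y x] assms null_swap[OF assms] by blast

lemma cls_self: "cauchy x \<Longrightarrow> (\<lambda>n. app (x n)) \<in> cls x"
  by (rule clsI) simp_all

lemma cls_eqD:
  assumes "cauchy y" "cls x = cls y"
  shows "null (\<lambda>n. x n - y n)"
proof -
  have "(\<lambda>n. app (y n)) \<in> cls x" using cls_self[OF assms(1)] assms(2) by simp
  then show ?thesis unfolding cls_def app_seq_inject by (auto simp: app_seq_inject)
qed

lemma L2_eq: "L2 M \<rho> = {cls x | x. cauchy x}"
proof -
  have "L2 M \<rho> = (\<lambda>x. equiv2 M \<rho> `` {x}) ` {\<lambda>n. app (z n) | z. cauchy z}"
    unfolding L2_def quotient_def cauchy2_eq by blast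
  also have "\<dots> = {cls x | x. cauchy x}" using equiv2_Image by (auto intro!: image_eqI)
  finally show ?thesis .
qed

lemma L2_norm_cls:
  assumes "cauchy x"
  shows "L2_norm \<rho> (cls x) = lnorm x"
  unfolding L2_norm_def
proof (rule the_equality)
  show "\<forall>y\<in>cls x. (\<lambda>n. norm2 \<rho> (y n)) \<longlonglongrightarrow> lnorm x"
    using nrm_tendsto_null[OF assms] by (auto simp: cls_def norm2_app)
  fix r assume "\<forall>y\<in>cls x. (\<lambda>n. norm2 \<rho> (y n)) \<longlonglongrightarrow> r"
  then have "(\<lambda>n. nrm (x n)) \<longlonglongrightarrow> r" using cls_self[OF assms] by (force simp: norm2_app)
  then show "r = lnorm x" using lnorm_tendsto[OF assms] LIMSEQ_unique by blast
qed

lemma equiv2_Image_subset: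
  assumes "cauchy x" "(\<lambda>n. app (x n)) \<in> S" "S \<subseteq> cls x"
  shows "equiv2 M \<rho> `` S = cls x"
proof -
  have "equiv2 M \<rho> `` {s} = cls x" if s: "s \<in> S" for s
  proof -
    obtain z where z: "s = (\<lambda>n. app (z n))" "cauchy z" "null (\<lambda>n. x n - z n)"
      by (rule clsE[OF subsetD[OF assms(3) s]])
    show ?thesis
      unfolding z(1) equiv2_Image[OF z(2)] by (rule cls_eqI[OF z(3), symmetric])
  qed
  with assms(2) show ?thesis unfolding Image_def by blast
qed

lemma L2_add_cls:
  assumes xy: "cauchy x" "cauchy y"
  shows "L2_add M \<rho> (cls x) (cls y) = cls (\<lambda>n. x n + y n)"
  unfolding L2_add_def
proof (rule equiv2_Image_subset)
  show "cauchy (\<lambda>n. x n + y n)" by (rule cauchy_add[OF xy])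
  show "(\<lambda>n. app (x n + y n)) \<in> {\<lambda>n. op_add UNIV (a n) (b n) |a b. a \<in> cls x \<and> b \<in> cls y}"
    unfolding op_UNIV_app(1)[symmetric] using cls_self[OF xy(1)] cls_self[OF xy(2)]
    by (intro CollectI exI[of _ "\<lambda>n. app (x n)"] exI[of _ "\<lambda>n. app (y n)"]) simp
  show "{\<lambda>n. op_add UNIV (a n) (b n) |a b. a \<in> cls x \<and> b \<in> cls y} \<subseteq> cls (\<lambda>n. x n + y n)"
  proof safe
    fix a b assume "a \<in> cls x" "b \<in> cls y"
    then obtain u v where u: "a = (\<lambda>n. app (u n))" "cauchy u" "null (\<lambda>n. x n - u n)"
      and v: "b = (\<lambda>n. app (v n))" "cauchy v" "null (\<lambda>n. y n - v n)"
      by (elim clsE)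
    have "null (\<lambda>n. (x n + y n) - (u n + v n))"
      using null_add[OF u(3) v(3)] by (simp add: algebra_simps)
    then show "(\<lambda>n. op_add UNIV (a n) (b n)) \<in> cls (\<lambda>n. x n + y n)"
      unfolding u(1) v(1) op_UNIV_app by (rule clsI[OF cauchy_add[OF u(2) v(2)]])
  qed
qed

lemma L2_scale_cls:
  assumes x: "cauchy x"
  shows "L2_scale M \<rho> c (cls x) = cls (\<lambda>n. scal c * x n)"
  unfolding L2_scale_def
proof (rule equiv2_Image_subset)
  show "cauchy (\<lambda>n. scal c * x n)" by (rule cauchy_scal[OF x])
  show "(\<lambda>n. app (scal c * x n)) \<in> {\<lambda>n. op_scale UNIV c (a n) |a. a \<in> cls x}"
    unfolding op_UNIV_app(3)[symmetric] using cls_self[OF x]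
    by (intro CollectI exI[of _ "\<lambda>n. app (x n)"]) simp
  show "{\<lambda>n. op_scale UNIV c (a n) |a. a \<in> cls x} \<subseteq> cls (\<lambda>n. scal c * x n)"
  proof safe
    fix a assume "a \<in> cls x"
    then obtain u where u: "a = (\<lambda>n. app (u n))" "cauchy u" "null (\<lambda>n. x n - u n)"
      by (elim clsE)
    have "null (\<lambda>n. scal c * x n - scal c * u n)"
      using null_scal[OF u(3), of c] by (simp add: right_diff_distrib)
    then show "(\<lambda>n. op_scale UNIV c (a n)) \<in> cls (\<lambda>n. scal c * x n)"
      unfolding u(1) op_UNIV_app by (rule clsI[OF cauchy_scal[OF u(2)]])
  qed
qed

lemma L2_nonneg_cls:
  assumes "L2_nonneg (cls x)"
  obtains p where "cauchy p" "\<And>n. pos (p n)" "null (\<lambda>n. x n - p n)"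
proof -
  obtain p' where p': "p' \<in> cls x" "\<forall>n. positive_op (p' n)" using assms unfolding L2_nonneg_def by blast
  then obtain p where "p' = (\<lambda>n. app (p n))" "cauchy p" "null (\<lambda>n. x n - p n)"
    by (elim clsE)
  with p' that show ?thesis by (simp add: positive_op_app)
qed

text \<open>If \<open>-h \<le> k \<le> h\<close> then \<open>h + k\<close> and \<open>h - k\<close> are positive. Half their sum is \<open>h\<close>, half their
  difference is \<open>k\<close>, and for positive elements the norm of the difference is at most that of the sum.\<close>

lemma lnorm_le_of_dominated:
  assumes h: "cauchy h" and k: "cauchy k"
    and plus: "L2_nonneg (cls (\<lambda>n. h n + k n))" and minus: "L2_nonneg (cls (\<lambda>n. h n - k n))"
  shows "lnorm k \<le> lnorm h"
proof -
  obtain p where p: "cauchy p" "\<And>n. pos (p n)" "null (\<lambda>n. h n + k n - p n)"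
    by (rule L2_nonneg_cls[OF plus]) blast
  obtain q where q: "cauchy q" "\<And>n. pos (q n)" "null (\<lambda>n. h n - k n - q n)"
    by (rule L2_nonneg_cls[OF minus]) blast
  have h': "cauchy (\<lambda>n. (1/2) *\<^sub>R (p n + q n))"
    by (intro cauchy_scaleR cauchy_add p q)
  have k': "cauchy (\<lambda>n. (1/2) *\<^sub>R (p n + (- 1) *\<^sub>R q n))"
    by (intro cauchy_scaleR cauchy_add p q)
  have "h n - (1/2) *\<^sub>R (p n + q n) = (1/2) *\<^sub>R ((h n + k n - p n) + (h n - k n - q n))" for n
    by (simp add: algebra_simps) (simp flip: scaleR_add_left)
  then have "null (\<lambda>n. h n - (1/2) *\<^sub>R (p n + q n))"
    using null_scaleR[OF null_add[OF p(3) q(3)], of "1/2"] by presburger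
  then have lh: "(\<lambda>n. nrm ((1/2) *\<^sub>R (p n + q n))) \<longlonglongrightarrow> lnorm h"
    by (rule nrm_tendsto_null[OF h h'])
  have "k n - (1/2) *\<^sub>R (p n + (- 1) *\<^sub>R q n) = (1/2) *\<^sub>R ((h n + k n - p n) - (h n - k n - q n))" for n
    by (simp add: algebra_simps) (simp flip: scaleR_add_left)
  then have "null (\<lambda>n. k n - (1/2) *\<^sub>R (p n + (- 1) *\<^sub>R q n))"
    using null_scaleR[OF null_diff[OF p(3) q(3)], of "1/2"] by presburger
  then have lk: "(\<lambda>n. nrm ((1/2) *\<^sub>R (p n + (- 1) *\<^sub>R q n))) \<longlonglongrightarrow> lnorm k"
    by (rule nrm_tendsto_null[OF k k'])
  have "nrm ((1/2) *\<^sub>R (p n + (- 1) *\<^sub>R q n)) \<le> nrm ((1/2) *\<^sub>R (p n + q n))" for n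
  proof -
    have "J (p n)" "J (q n)" using p q by auto
    then show ?thesis
      using nrm_diff_le_add[of "p n" "q n"] p q nrm_scaleR[of "p n - q n" "1/2"]
        nrm_scaleR[of "p n + q n" "1/2"] by simp
  qed
  then show ?thesis by (intro LIMSEQ_le[OF lk lh] exI allI impI)
qed

end

section \<open>Operators on a dense domain\<close>

lemma cinner_add_right: "cinner x (y + z) = cinner x y + cinner x (z::'a::complex_hilbert)"
  by (metis cinner_add_left cinner_commute complex_cnj_add)

lemma orthogonal_dense_eq_zero:
  fixes x :: "'a::complex_hilbert"
  assumes dense: "closure D = UNIV" and orth: "\<And>y. y \<in> D \<Longrightarrow> inner y x = 0"
  shows "x = 0"
proof -
  have "x \<in> closure D" using dense by simp
  then obtain z where z: "\<And>n. z n \<in> D" "z \<longlonglongrightarrow> x" unfolding closure_sequential by blast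
  have "(\<lambda>n. inner (z n) x) \<longlonglongrightarrow> inner x x" by (intro tendsto_intros z)
  moreover have "(\<lambda>n. inner (z n) x) = (\<lambda>n. 0)" using z(1) orth by simp
  ultimately have "inner x x = 0" by (simp add: LIMSEQ_const_iff)
  then show ?thesis by simp
qed

text \<open>With a densely defined adjoint, any limit of \<open>A (\<xi> n)\<close> along \<open>\<xi> n \<longlonglongrightarrow> 0\<close> is orthogonal to \<open>D\<close>. So
  closability is automatic in \<^const>\<open>L_dagger\<close>, and its closure under sums follows.\<close>

lemma closable_of_adj_dom:
  assumes dense: "closure D = UNIV" and dom: "D \<subseteq> adj_dom D A"
  shows "closable_op D A"
  unfolding closable_op_def
proof (intro allI impI, elim conjE)
  fix \<xi> \<eta> assume \<xi>: "\<forall>n. \<xi> n \<in> D" "\<xi> \<longlonglongrightarrow> 0" "(\<lambda>n. A (\<xi> n)) \<longlonglongrightarrow> \<eta>"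
  show "\<eta> = 0"
  proof (rule orthogonal_dense_eq_zero[OF dense])
    fix y assume "y \<in> D"
    with dom obtain \<zeta> where \<zeta>: "\<forall>\<xi>\<in>D. cinner (A \<xi>) y = cinner \<xi> \<zeta>" unfolding adj_dom_def by blast
    have "inner (A (\<xi> n)) y = inner (\<xi> n) \<zeta>" for n using \<zeta> \<xi>(1) by (metis Re_cinner)
    moreover have "(\<lambda>n. inner (A (\<xi> n)) y) \<longlonglongrightarrow> inner \<eta> y" by (intro tendsto_intros \<xi>)
    moreover have "(\<lambda>n. inner (\<xi> n) \<zeta>) \<longlonglongrightarrow> inner 0 \<zeta>" by (intro tendsto_intros \<xi>)
    ultimately have "inner \<eta> y = inner 0 \<zeta>" using LIMSEQ_unique by fastforce
    then show "inner y \<eta> = 0" by (simp add: inner_commute)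
  qed
qed

locale dense_domain =
  fixes D :: "'h::complex_hilbert set"
  assumes sub: "csubspace D" and dense: "closure D = UNIV"
begin

lemma L_daggerI: "linear_op D A \<Longrightarrow> D \<subseteq> adj_dom D A \<Longrightarrow> A \<in> L_dagger D"
  by (simp add: L_dagger_def closable_of_adj_dom[OF dense])

lemma D_add: "x \<in> D \<Longrightarrow> y \<in> D \<Longrightarrow> x + y \<in> D" and D_scale: "x \<in> D \<Longrightarrow> c *\<^sub>C x \<in> D"
  using sub by (auto simp: csubspace_def)

lemma L_dagger_id: "op_id D \<in> L_dagger D"
  by (rule L_daggerI) (auto simp: linear_op_def op_id_def adj_dom_def D_add D_scale)

lemma L_dagger_add:
  assumes "S \<in> L_dagger D" "T \<in> L_dagger D"
  shows "op_add D S T \<in> L_dagger D"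
proof (rule L_daggerI)
  show "linear_op D (op_add D S T)"
    using assms unfolding L_dagger_def
    by (auto simp: linear_op_def op_add_def D_add D_scale scaleC_add_right)
  show "D \<subseteq> adj_dom D (op_add D S T)"
  proof
    fix y assume "y \<in> D"
    then obtain z1 z2 where "\<forall>x\<in>D. cinner (S x) y = cinner x z1" "\<forall>x\<in>D. cinner (T x) y = cinner x z2"
      using assms unfolding L_dagger_def adj_dom_def by blast
    then show "y \<in> adj_dom D (op_add D S T)"
      unfolding adj_dom_def op_add_def
      by (intro CollectI exI[of _ "z1 + z2"]) (simp add: cinner_add_left cinner_add_right)
  qed
qed

lemma L_dagger_scale:
  assumes "T \<in> L_dagger D"
  shows "op_scale D c T \<in> L_dagger D"
proof (rule L_daggerI)
  show "linear_op D (op_scale D c T)"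
    using assms unfolding L_dagger_def
    by (auto simp: linear_op_def op_scale_def D_add D_scale scaleC_add_right scaleC_scaleC mult.commute)
  show "D \<subseteq> adj_dom D (op_scale D c T)"
  proof
    fix y assume "y \<in> D"
    then obtain z where "\<forall>x\<in>D. cinner (T x) y = cinner x z"
      using assms unfolding L_dagger_def adj_dom_def by blast
    then show "y \<in> adj_dom D (op_scale D c T)"
      unfolding adj_dom_def op_scale_def
      by (intro CollectI exI[of _ "cnj c *\<^sub>C z"]) (simp add: cinner_scaleC_left cinner_scaleC_right)
  qed
qed

lemma dagger_id: "dagger D (op_id D) = op_id D"
proof
  fix y
  have dom: "y \<in> adj_dom D (op_id D)" unfolding adj_dom_def op_id_def by auto
  have "(THE z. \<forall>x\<in>D. cinner (op_id D x) y = cinner x z) = y"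
  proof (rule the_equality)
    show "\<forall>x\<in>D. cinner (op_id D x) y = cinner x y" by (simp add: op_id_def)
    fix z assume z: "\<forall>x\<in>D. cinner (op_id D x) y = cinner x z"
    have "inner x (z - y) = 0" if "x \<in> D" for x
      using z that by (simp add: op_id_def inner_diff_right) (metis Re_cinner)
    then have "z - y = 0" by (rule orthogonal_dense_eq_zero[OF dense])
    then show "z = y" by simp
  qed
  then show "dagger D (op_id D) y = op_id D y"
    using dom by (simp add: dagger_def adj_def op_id_def restrict_def)
qed

lemma L_dagger_b_id: "op_id D \<in> L_dagger_b D"
proof -
  have "bounded_op D (op_id D)" unfolding bounded_op_def by (intro exI[of _ 1]) (simp add: op_id_def)
  then show ?thesis by (auto simp: L_dagger_b_def L_dagger_id dagger_id) (auto simp: op_id_def)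
qed

lemma compose_id: "A \<in> L_dagger D \<Longrightarrow> compose D A (op_id D) = A"
  by (auto simp: L_dagger_def linear_op_def compose_def op_id_def restrict_def extensional_def)

lemma op_diff_scale_id:
  "op_diff D A (op_scale D (complex_of_real t) (op_id D))
    = op_add D A (op_scale D (complex_of_real (- t)) (op_id D))"
  by (rule ext) (simp add: op_diff_def op_add_def op_scale_def op_id_def scaleC_minus_left)

end

section \<open>The uncertainty relation\<close>

locale positive_form = traced_algebra M \<rho> + dense_domain D
  for M :: "('k::complex_hilbert \<Rightarrow> 'k) set" and \<rho> :: "('k \<Rightarrow> 'k) \<Rightarrow> ennreal"
    and D :: "'h::complex_hilbert set" +
  fixes \<Phi> :: "('h \<Rightarrow> 'h) \<Rightarrow> ('h \<Rightarrow> 'h) \<Rightarrow> (nat \<Rightarrow> 'k \<Rightarrow> 'k) set"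
  assumes sesq: "sesquilinear_L2 D M \<rho> \<Phi>" and positive: "positive_sesq D \<Phi>"
begin

text \<open>A Cauchy sequence in the class \<open>\<Phi> S T\<close>. Equations between values of \<open>\<Phi>\<close> become statements that
  a combination of representatives is a null sequence, and these can be added up.\<close>

definition rep :: "('h \<Rightarrow> 'h) \<Rightarrow> ('h \<Rightarrow> 'h) \<Rightarrow> nat \<Rightarrow> 'k bop" where
  "rep S T = (SOME x. cauchy x \<and> \<Phi> S T = cls x)"

lemma rep:
  assumes "S \<in> L_dagger D" "T \<in> L_dagger D"
  shows cauchy_rep: "cauchy (rep S T)" and cls_rep: "\<Phi> S T = cls (rep S T)"
proof -
  have "\<Phi> S T \<in> L2 M \<rho>" using sesq assms by (simp add: sesquilinear_L2_def)
  then have "\<exists>x. cauchy x \<and> \<Phi> S T = cls x" unfolding L2_eq by blast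
  from someI_ex[OF this] show "cauchy (rep S T)" "\<Phi> S T = cls (rep S T)"
    unfolding rep_def by blast+
qed

lemma rep_linear_left:
  assumes L: "S \<in> L_dagger D" "T \<in> L_dagger D" "U \<in> L_dagger D"
  shows "null (\<lambda>n. rep (op_add D S (op_scale D c T)) U n - (rep S U n + scal c * rep T U n))"
proof (rule cls_eqD)
  have c: "cauchy (\<lambda>n. scal c * rep T U n)" using L by (intro cauchy_scal cauchy_rep)
  then show "cauchy (\<lambda>n. rep S U n + scal c * rep T U n)" using L by (intro cauchy_add cauchy_rep)
  have cT: "op_scale D c T \<in> L_dagger D" using L by (intro L_dagger_add L_dagger_scale)
  then have "op_add D S (op_scale D c T) \<in> L_dagger D" using L by (intro L_dagger_add L_dagger_scale)
  then have "cls (rep (op_add D S (op_scale D c T)) U) = \<Phi> (op_add D S (op_scale D c T)) U"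
    using L by (simp add: cls_rep)
  also have "\<dots> = L2_add M \<rho> (\<Phi> S U) (L2_scale M \<rho> c (\<Phi> T U))"
    using sesq L cT by (simp add: sesquilinear_L2_def)
  also have "\<dots> = cls (\<lambda>n. rep S U n + scal c * rep T U n)"
    using L c by (simp add: cls_rep cauchy_rep L2_scale_cls L2_add_cls)
  finally show "cls (rep (op_add D S (op_scale D c T)) U) = cls (\<lambda>n. rep S U n + scal c * rep T U n)" .
qed

lemma rep_linear_right:
  assumes L: "S \<in> L_dagger D" "T \<in> L_dagger D" "U \<in> L_dagger D"
  shows "null (\<lambda>n. rep U (op_add D S (op_scale D c T)) n - (rep U S n + scal (cnj c) * rep U T n))"
proof (rule cls_eqD)
  have c: "cauchy (\<lambda>n. scal (cnj c) * rep U T n)" using L by (intro cauchy_scal cauchy_rep)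
  then show "cauchy (\<lambda>n. rep U S n + scal (cnj c) * rep U T n)"
    using L by (intro cauchy_add cauchy_rep)
  have cT: "op_scale D c T \<in> L_dagger D" using L by (intro L_dagger_add L_dagger_scale)
  then have "op_add D S (op_scale D c T) \<in> L_dagger D" using L by (intro L_dagger_add L_dagger_scale)
  then have "cls (rep U (op_add D S (op_scale D c T))) = \<Phi> U (op_add D S (op_scale D c T))"
    using L by (simp add: cls_rep)
  also have "\<dots> = L2_add M \<rho> (\<Phi> U S) (L2_scale M \<rho> (cnj c) (\<Phi> U T))"
    using sesq L cT by (simp add: sesquilinear_L2_def)
  also have "\<dots> = cls (\<lambda>n. rep U S n + scal (cnj c) * rep U T n)"
    using L c by (simp add: cls_rep cauchy_rep L2_scale_cls L2_add_cls)
  finally show "cls (rep U (op_add D S (op_scale D c T)))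
      = cls (\<lambda>n. rep U S n + scal (cnj c) * rep U T n)" .
qed

lemma null_cong: "null x \<Longrightarrow> (\<And>n. y n = x n) \<Longrightarrow> null y"
  by presburger

text \<open>The sequence represents \<open>\<Phi> Z Z\<close> for \<open>Z = P + \<i> t Q\<close>: the mixed terms are
  \<open>-\<i> t (\<Phi> P Q - \<Phi> Q P) = -\<i> t (\<i> k) = t k\<close>.\<close>

lemma rep_quadratic:
  fixes t :: real
  assumes L: "P \<in> L_dagger D" "Q \<in> L_dagger D"
    and comm: "null (\<lambda>n. rep P Q n - rep Q P n - scal \<i> * k n)"
  shows "L2_nonneg (cls (\<lambda>n. (rep P P n + t\<^sup>2 *\<^sub>R rep Q Q n) + t *\<^sub>R k n))"
proof -
  define Z where "Z = op_add D P (op_scale D (\<i> * complex_of_real t) Q)"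
  define w where "w = (scal (\<i> * complex_of_real t) :: 'k bop)"
  have Z: "Z \<in> L_dagger D" unfolding Z_def by (intro L_dagger_add L_dagger_scale L)
  have w_cnj: "scal (cnj (\<i> * complex_of_real t)) = - w"
    by (simp add: w_def scal_uminus)
  have ww: "w * (w * x) = - (t\<^sup>2 *\<^sub>R x)" for x
  proof -
    have "\<i> * complex_of_real t * (\<i> * complex_of_real t) = complex_of_real (- (t\<^sup>2))"
      by (simp add: complex_eq_iff power2_eq_square)
    then show ?thesis
      unfolding w_def mult.assoc[symmetric] scal_mult[symmetric] by (simp only: scal_of_real) simp
  qed
  have wi: "w * (scal \<i> * x) = - (t *\<^sub>R x)" for x
  proof -
    have "\<i> * complex_of_real t * \<i> = complex_of_real (- t)" by (simp add: complex_eq_iff)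
    then show ?thesis
      unfolding w_def mult.assoc[symmetric] scal_mult[symmetric] by (simp only: scal_of_real) simp
  qed
  note e1 = rep_linear_left[OF L Z, of "\<i> * complex_of_real t", folded Z_def w_def]
  note e2 = rep_linear_right[OF L L(1), of "\<i> * complex_of_real t", folded Z_def, unfolded w_cnj]
  note e3 = rep_linear_right[OF L L(2), of "\<i> * complex_of_real t", folded Z_def, unfolded w_cnj]
  have "null (\<lambda>n. w * (rep Q Z n - (rep Q P n + - w * rep Q Q n)))"
    "null (\<lambda>n. w * (rep P Q n - rep Q P n - scal \<i> * k n))"
    unfolding w_def using null_scal e3 comm unfolding w_def by blast+
  \<comment> \<open>Expanding \<open>\<Phi> Z Z\<close> first on the left and then on the right leaves the error \<open>e1 + e2 + w e3\<close>; the
    commutator relation, multiplied by \<open>w\<close>, turns the mixed terms into \<open>t k\<close>.\<close>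
  from null_diff[OF null_add[OF null_add[OF e1 e2] this(1)] this(2)]
  have "null (\<lambda>n. rep Z Z n - ((rep P P n + t\<^sup>2 *\<^sub>R rep Q Q n) + t *\<^sub>R k n))"
    by (rule null_cong) (simp add: algebra_simps ww wi)
  from cls_eqI[OF this] have "cls (\<lambda>n. (rep P P n + t\<^sup>2 *\<^sub>R rep Q Q n) + t *\<^sub>R k n) = \<Phi> Z Z"
    by (simp add: cls_rep Z)
  then show ?thesis using positive Z by (simp add: positive_sesq_def)
qed

text \<open>Using \<open>t\<close> and \<open>-t\<close> traps \<open>t k\<close> between \<open>-h\<close> and \<open>h\<close> for \<open>h = \<Phi> P P + t\<^sup>2 \<Phi> Q Q\<close>. Therefore
  \<open>t \<parallel>k\<parallel> \<le> \<parallel>\<Phi> P P\<parallel> + t\<^sup>2 \<parallel>\<Phi> Q Q\<parallel>\<close>, and it remains to optimize over \<open>t\<close>.\<close>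

lemma lnorm_commutator_le:
  assumes L: "P \<in> L_dagger D" "Q \<in> L_dagger D" and k: "cauchy k"
    and comm: "null (\<lambda>n. rep P Q n - rep Q P n - scal \<i> * k n)"
  shows "lnorm k \<le> 2 * (sqrt (lnorm (rep P P)) * sqrt (lnorm (rep Q Q)))"
proof (rule mean_inequality_limit)
  show "0 \<le> lnorm (rep P P)" "0 \<le> lnorm (rep Q Q)" by (intro lnorm_nonneg cauchy_rep L)+
  fix t :: real assume t: "0 < t"
  have tQ: "cauchy (\<lambda>n. t\<^sup>2 *\<^sub>R rep Q Q n)" by (intro cauchy_scaleR cauchy_rep L)
  have h: "cauchy (\<lambda>n. rep P P n + t\<^sup>2 *\<^sub>R rep Q Q n)" by (intro cauchy_add tQ cauchy_rep L)
  have "lnorm (\<lambda>n. t *\<^sub>R k n) \<le> lnorm (\<lambda>n. rep P P n + t\<^sup>2 *\<^sub>R rep Q Q n)"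
  proof (rule lnorm_le_of_dominated[OF h cauchy_scaleR[OF k]])
    show "L2_nonneg (cls (\<lambda>n. rep P P n + t\<^sup>2 *\<^sub>R rep Q Q n + t *\<^sub>R k n))"
      by (rule rep_quadratic[OF L comm])
    show "L2_nonneg (cls (\<lambda>n. rep P P n + t\<^sup>2 *\<^sub>R rep Q Q n - t *\<^sub>R k n))"
      using rep_quadratic[OF L comm, of "- t"] by simp
  qed
  also have "\<dots> \<le> lnorm (rep P P) + lnorm (\<lambda>n. t\<^sup>2 *\<^sub>R rep Q Q n)"
    by (rule lnorm_add_le[OF cauchy_rep[OF L(1) L(1)] tQ])
  finally have "t * lnorm k \<le> lnorm (rep P P) + t * t * lnorm (rep Q Q)"
    using t by (simp add: lnorm_scaleR k cauchy_rep L power2_eq_square)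
  then have "t * lnorm k \<le> t * (lnorm (rep P P) / t + t * lnorm (rep Q Q))"
    using t by (simp add: algebra_simps)
  then show "lnorm k \<le> lnorm (rep P P) / t + t * lnorm (rep Q Q)"
    using t by (simp only: mult_le_cancel_left_pos)
qed

text \<open>Shifting by real multiples of the identity changes \<open>\<Phi> A B - \<Phi> B A\<close> by multiples of
  \<open>\<Phi> A I - \<Phi> I A\<close> and \<open>\<Phi> B I - \<Phi> I B\<close>, which vanish.\<close>

lemma rep_shifted_commutator:
  fixes lam mu :: real
  assumes L: "A \<in> L_dagger D" "B \<in> L_dagger D" "K \<in> L_dagger D"
    and A: "\<Phi> A (op_id D) = \<Phi> (op_id D) A" and B: "\<Phi> B (op_id D) = \<Phi> (op_id D) B"
    and comm: "L2_diff M \<rho> (\<Phi> A B) (\<Phi> B A) = \<Phi> (op_scale D \<i> K) (op_id D)"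
  defines "P \<equiv> op_add D A (op_scale D (complex_of_real (- lam)) (op_id D))"
    and "Q \<equiv> op_add D B (op_scale D (complex_of_real (- mu)) (op_id D))"
  shows "null (\<lambda>n. rep P Q n - rep Q P n - scal \<i> * rep K (op_id D) n)"
proof -
  let ?I = "op_id D"
  note I = L_dagger_id
  have P: "P \<in> L_dagger D" unfolding P_def by (intro L_dagger_add L_dagger_scale L I)
  have Q: "Q \<in> L_dagger D" unfolding Q_def by (intro L_dagger_add L_dagger_scale L I)
  have real: "scal (complex_of_real r) * x = r *\<^sub>R x"
    "scal (cnj (complex_of_real r)) * x = r *\<^sub>R x" for r and x :: "'k bop"
    by (simp_all add: scal_of_real)
  note left = rep_linear_left[OF _ I, of _ _ "complex_of_real r" for r, unfolded real]
  note right = rep_linear_right[OF _ I, of _ _ "complex_of_real r" for r, unfolded real]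
  note e1 = left[OF L(1) Q, of "- lam", folded P_def]
  note e2 = right[OF L(2) L(1), of "- mu", folded Q_def]
  note e3 = right[OF L(2) I, of "- mu", folded Q_def]
  note e4 = left[OF L(2) P, of "- mu", folded Q_def]
  note e5 = right[OF L(1) L(2), of "- lam", folded P_def]
  note e6 = right[OF L(1) I, of "- lam", folded P_def]
  have e7: "null (\<lambda>n. rep A ?I n - rep ?I A n)"
    using A L I by (intro cls_eqD cauchy_rep) (simp_all add: cls_rep)
  have e8: "null (\<lambda>n. rep B ?I n - rep ?I B n)"
    using B L I by (intro cls_eqD cauchy_rep) (simp_all add: cls_rep)
  have e9: "null (\<lambda>n. (rep A B n + scal (- 1) * rep B A n) - scal \<i> * rep K ?I n)"
  proof (rule cls_eqD)
    show iK: "cauchy (\<lambda>n. scal \<i> * rep K ?I n)" by (intro cauchy_scal cauchy_rep L I)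
    have BA: "cauchy (\<lambda>n. scal (- 1) * rep B A n)" by (intro cauchy_scal cauchy_rep L)
    have "cls (\<lambda>n. rep A B n + scal (- 1) * rep B A n) = L2_diff M \<rho> (\<Phi> A B) (\<Phi> B A)"
      using L BA by (simp add: L2_diff_def cls_rep cauchy_rep L2_scale_cls L2_add_cls)
    also have "\<dots> = L2_scale M \<rho> \<i> (\<Phi> K ?I)"
      using sesq L I by (simp add: comm sesquilinear_L2_def)
    also have "\<dots> = cls (\<lambda>n. scal \<i> * rep K ?I n)"
      using L I by (simp add: cls_rep cauchy_rep L2_scale_cls)
    finally show "cls (\<lambda>n. rep A B n + scal (- 1) * rep B A n) = cls (\<lambda>n. scal \<i> * rep K ?I n)" .
  qed
  have minus_one: "scal (- 1) * x = - x" for x :: "'k bop"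
    using real(1)[of "- 1" x] by simp
  \<comment> \<open>The combination \<open>(e1 + e2 - lam e3) - (e4 + e5 - mu e6) + (lam e8 - mu e7) + e9\<close>, in which all
    representatives other than those in the claim cancel.\<close>
  note E = null_add[OF null_diff[OF
      null_diff[OF null_add[OF e1 e2] null_scaleR[OF e3, of lam]]
      null_diff[OF null_add[OF e4 e5] null_scaleR[OF e6, of mu]]]
      null_add[OF null_diff[OF null_scaleR[OF e8, of lam] null_scaleR[OF e7, of mu]] e9]]
  show ?thesis
    by (rule null_cong[OF E]) (simp add: algebra_simps minus_one)
qed

end

theorem proposition3p4:
  fixes D :: "'h::complex_hilbert set"
    and M :: "('k::complex_hilbert \<Rightarrow> 'k) set"
    and \<rho> :: "('k \<Rightarrow> 'k) \<Rightarrow> ennreal"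
    and \<Phi> :: "('h \<Rightarrow> 'h) \<Rightarrow> ('h \<Rightarrow> 'h) \<Rightarrow> (nat \<Rightarrow> 'k \<Rightarrow> 'k) set"
    and A B K :: "'h \<Rightarrow> 'h"
    and lam mu :: real
  assumes "csubspace D" and "closure D = UNIV"
    and "von_neumann_algebra M" and "trace_on M \<rho>"
    and "faithful_trace M \<rho>" and "normal_trace M \<rho>" and "semifinite_trace M \<rho>"
    and "sesquilinear_L2 D M \<rho> \<Phi>" and "positive_sesq D \<Phi>"
    and "A \<in> L_dagger D" and "symmetric_op D A"
    and "B \<in> L_dagger D" and "symmetric_op D B"
    and "K \<in> L_dagger D" and "symmetric_op D K"
    and "\<And>X Y. X \<in> L_dagger_b D \<Longrightarrow> Y \<in> L_dagger_b D \<Longrightarrow>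
           \<Phi> (compose D A X) Y = \<Phi> X (compose D A Y)"
    and "\<And>X Y. X \<in> L_dagger_b D \<Longrightarrow> Y \<in> L_dagger_b D \<Longrightarrow>
           \<Phi> (compose D B X) Y = \<Phi> X (compose D B Y)"
    and "\<And>X Y. X \<in> L_dagger_b D \<Longrightarrow> Y \<in> L_dagger_b D \<Longrightarrow>
           L2_diff M \<rho> (\<Phi> (compose D A X) (compose D B Y)) (\<Phi> (compose D B X) (compose D A Y))
           = \<Phi> (op_scale D \<i> (compose D K X)) Y"
  shows "uncertainty D \<rho> \<Phi> A lam * uncertainty D \<rho> \<Phi> B mu \<ge> 1/2 * gamma_norm D \<rho> \<Phi> K"
proof -
  interpret positive_form M \<rho> D \<Phi>
    using assms by unfold_locales
  let ?I = "op_id D"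
  define P where "P = op_add D A (op_scale D (complex_of_real (- lam)) ?I)"
  define Q where "Q = op_add D B (op_scale D (complex_of_real (- mu)) ?I)"
  note L = \<open>A \<in> L_dagger D\<close> \<open>B \<in> L_dagger D\<close> \<open>K \<in> L_dagger D\<close>
  have P: "P \<in> L_dagger D" unfolding P_def by (intro L_dagger_add L_dagger_scale L L_dagger_id)
  have Q: "Q \<in> L_dagger D" unfolding Q_def by (intro L_dagger_add L_dagger_scale L L_dagger_id)
  have "null (\<lambda>n. rep P Q n - rep Q P n - scal \<i> * rep K ?I n)"
    unfolding P_def Q_def
    using assms(16-18)[OF L_dagger_b_id L_dagger_b_id] L
    by (intro rep_shifted_commutator) (simp_all add: compose_id)
  then have "lnorm (rep K ?I) \<le> 2 * (sqrt (lnorm (rep P P)) * sqrt (lnorm (rep Q Q)))"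
    by (intro lnorm_commutator_le P Q cauchy_rep L L_dagger_id)
  moreover have "uncertainty D \<rho> \<Phi> A lam = sqrt (lnorm (rep P P))"
    unfolding uncertainty_def Let_def op_diff_scale_id P_def[symmetric]
    by (simp add: cls_rep L2_norm_cls cauchy_rep P)
  moreover have "uncertainty D \<rho> \<Phi> B mu = sqrt (lnorm (rep Q Q))"
    unfolding uncertainty_def Let_def op_diff_scale_id Q_def[symmetric]
    by (simp add: cls_rep L2_norm_cls cauchy_rep Q)
  moreover have "gamma_norm D \<rho> \<Phi> K = lnorm (rep K ?I)"
    unfolding gamma_norm_def by (simp add: cls_rep L2_norm_cls cauchy_rep L L_dagger_id)
  ultimately show ?thesis by simp
qed

end
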